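(* Let $s\in(0,1)$, $N>2s$, $k\ge2$ and let $\bm{\lambda}=(\lambda_1,\dots,\lambda_k)\in\mathbb{R}^k$ with $\lambda_1\le\dots\le\lambda_k$. If $$\lambda_i>h_{N,s}\ \text{ for some } i\in\{1,\dots,k\}\qquad\text{or}\qquad \sum_{i=1}^k\lambda_i>h_{N,s},$$ then for any $\bm{a}=(a_1,\dots,a_k)\in\mathbb{R}^{kN}$ with $a_i\in\mathbb{R}^N$ and $a_i\ne a_j$ for $i\neq j$, there exists $u\in\mathcal{D}^{s,2}(\mathbb{R}^N)$ such that $Q_{\bm{\lambda},\bm{a}}(u)<0$. In particular, $\mu_{\bm{\lambda},\bm{a}}<0$ and the problem $$(-\Delta)^su-H_{\bm{\lambda},\bm{a}}u=u^{2^*_s-1}\ \text{ in }\mathbb{R}^N,\qquad u\ge0\ \text{ in }\mathbb{R}^N,$$ does not admit nontrivial (i.e. not identically zero) weak solutions.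
   Context: $\mathcal{D}^{s,2}(\mathbb{R}^N)$ is the completion of $C_c^\infty(\mathbb{R}^N)$ with respect to the norm induced by the scalar product $$(u,v)_{\mathcal{D}^{s,2}(\mathbb{R}^N)}=\frac{C_{N,s}}{2}\int_{\mathbb{R}^{2N}}\frac{(u(x)-u(y))(v(x)-v(y))}{|x-y|^{N+2s}}\,dx\,dy,\qquad C_{N,s}=\frac{2^{2s}}{\pi^{N/2}}\frac{\Gamma\left(\frac{N+2s}{2}\right)}{\Gamma(2-s)}s(1-s).$$ $2^*_s=\frac{2N}{N-2s}$. The constant $h_{N,s}>0$ is the best constant in the fractional Hardy inequality $h_{N,s}\int_{\mathbb{R}^N}\frac{u^2}{|x|^{2s}}\,dx\le\|u\|_{\mathcal{D}^{s,2}(\mathbb{R}^N)}^2$ for all $u\in\mathcal{D}^{s,2}(\mathbb{R}^N)$. Define $H_{\bm{\lambda},\bm{a}}(x)=\sum_{i=1}^k\frac{\lambda_i}{|x-a_i|^{2s}}$, $$Q_{\bm{\lambda},\bm{a}}(u,v)=(u,v)_{\mathcal{D}^{s,2}(\mathbb{R}^N)}-\int_{\mathbb{R}^N}H_{\bm{\lambda},\bm{a}}uv\,dx,\quad Q_{\bm{\lambda},\bm{a}}(u)=Q_{\bm{\lambda},\bm{a}}(u,u),\quad \mu_{\bm{\lambda},\bm{a}}=\inf_{u\in\mathcal{D}^{s,2}(\mathbb{R}^N)\setminus\{0\}}\frac{Q_{\bm{\lambda},\bm{a}}(u)}{\|u\|^2_{\mathcal{D}^{s,2}(\mathbb{R}^N)}}.$$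 A weak solution of the problem is a function $u\in L^1(\mathbb{R}^N;(1+|x|^{N+2s})^{-1}dx)$ such that $u\in\mathcal{D}^{s,2}(\mathbb{R}^N)$, $u\ge0$ a.e. in $\mathbb{R}^N$, and $Q_{\bm{\lambda},\bm{a}}(u,v)=\int_{\mathbb{R}^N}u^{2^*_s-1}v\,dx$ for all $v\in\mathcal{D}^{s,2}(\mathbb{R}^N)$. *)

theory Defs
  imports "HOL-Analysis.Analysis"
begin

(* Functions on R^N are real functions on a Euclidean space 'a with N = DIM('a).  Elements of
   function spaces are represented by Borel functions; "u = 0" there means "u = 0 a.e.". *)

(* C^n, through continuity of iterated partial derivatives along the standard basis. *)
primrec C_k :: "nat \<Rightarrow> ('a::euclidean_space \<Rightarrow> real) \<Rightarrow> bool" where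
  "C_k 0 f \<longleftrightarrow> continuous_on UNIV f"
| "C_k (Suc n) f \<longleftrightarrow>
     (\<forall>x. f differentiable (at x)) \<and>
     (\<forall>b\<in>Basis. C_k n (\<lambda>x. frechet_derivative f (at x) b))"

definition Cc_infinity :: "('a::euclidean_space \<Rightarrow> real) set" where
  "Cc_infinity = {f. (\<forall>n. C_k n f) \<and> compact (closure {x. f x \<noteq> 0})}"

definition C_const :: "nat \<Rightarrow> real \<Rightarrow> real" where
  "C_const N s =
     2 powr (2 * s) / pi powr (real N / 2)
       * (Gamma ((real N + 2 * s) / 2) / Gamma (2 - s)) * s * (1 - s)"

(* The integrand is 0 on the (null) diagonal, as 0 / 0 = 0. *)
definition D_inner ::
  "real \<Rightarrow> ('a::euclidean_space \<Rightarrow> real) \<Rightarrow> ('a \<Rightarrow> real) \<Rightarrow> real" where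
  "D_inner s u v = C_const DIM('a) s / 2 *
     (\<integral>(x, y). (u x - u y) * (v x - v y) / norm (x - y) powr (real DIM('a) + 2 * s)
        \<partial>(lborel \<Otimes>\<^sub>M lborel))"

definition D_norm :: "real \<Rightarrow> ('a::euclidean_space \<Rightarrow> real) \<Rightarrow> real" where
  "D_norm s u = sqrt (D_inner s u u)"

(* The completion of C_c^infinity, realized as a space of functions: the a.e. limits of sequences
   of test functions that are Cauchy for the norm.  For N > 2s this is the completion: by the
   Sobolev inequality every Cauchy sequence has a subsequence converging a.e., its limit is
   determined up to null sets by the class of the Cauchy sequence and determines that class,
   and, by Fatou, the norm of the limit is again given by D_norm. *)
definition D_space :: "real \<Rightarrow> ('a::euclidean_space \<Rightarrow> real) set" where
  "D_space s = {u \<in> borel_measurable borel.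
     \<exists>\<phi>. (\<forall>n::nat. \<phi> n \<in> Cc_infinity) \<and>
         (\<forall>e>0. \<exists>M. \<forall>m\<ge>M. \<forall>n\<ge>M. D_norm s (\<lambda>x. \<phi> m x - \<phi> n x) < e) \<and>
         (AE x in lborel. (\<lambda>n. \<phi> n x) \<longlonglongrightarrow> u x)}"

(* The best constant in the fractional Hardy inequality on 'a.  The weighted integral is taken in
   [0, infinity], so that a divergent one cannot satisfy the inequality with h > 0. *)
definition hardy_const :: "'a::euclidean_space itself \<Rightarrow> real \<Rightarrow> real" where
  "hardy_const T s = Sup {h. 0 \<le> h \<and>
     (\<forall>u \<in> (D_space s :: ('a \<Rightarrow> real) set).
        ennreal h * (\<integral>\<^sup>+x. ennreal ((u x)\<^sup>2 / norm x powr (2 * s)) \<partial>lborel)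
          \<le> ennreal ((D_norm s u)\<^sup>2))}"

definition crit_exp :: "nat \<Rightarrow> real \<Rightarrow> real" where
  "crit_exp N s = 2 * real N / (real N - 2 * s)"

(* Poles and coefficients are indexed by 1, ..., k; other values of lam and a are irrelevant. *)
definition H_pot ::
  "real \<Rightarrow> nat \<Rightarrow> (nat \<Rightarrow> real) \<Rightarrow> (nat \<Rightarrow> 'a::euclidean_space) \<Rightarrow> 'a \<Rightarrow> real" where
  "H_pot s k lam a x = (\<Sum>i=1..k. lam i / norm (x - a i) powr (2 * s))"

definition Q_form ::
  "real \<Rightarrow> nat \<Rightarrow> (nat \<Rightarrow> real) \<Rightarrow> (nat \<Rightarrow> 'a::euclidean_space)
     \<Rightarrow> ('a \<Rightarrow> real) \<Rightarrow> ('a \<Rightarrow> real) \<Rightarrow> real" where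
  "Q_form s k lam a u v = D_inner s u v - (\<integral>x. H_pot s k lam a x * u x * v x \<partial>lborel)"

(* The infimum is taken in the extended reals. *)
definition mu_inf ::
  "real \<Rightarrow> nat \<Rightarrow> (nat \<Rightarrow> real) \<Rightarrow> (nat \<Rightarrow> 'a::euclidean_space) \<Rightarrow> ereal" where
  "mu_inf s k lam a =
     (INF u \<in> {u \<in> D_space s. \<not> (AE x in lborel. u x = 0)}.
        ereal (Q_form s k lam a u u / (D_norm s u)\<^sup>2))"

definition weak_solution ::
  "real \<Rightarrow> nat \<Rightarrow> (nat \<Rightarrow> real) \<Rightarrow> (nat \<Rightarrow> 'a::euclidean_space) \<Rightarrow> ('a \<Rightarrow> real) \<Rightarrow> bool" where
  "weak_solution s k lam a u \<longleftrightarrow>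
     integrable lborel (\<lambda>x. u x / (1 + norm x powr (real DIM('a) + 2 * s))) \<and>
     u \<in> D_space s \<and>
     (AE x in lborel. u x \<ge> 0) \<and>
     (\<forall>v \<in> D_space s. Q_form s k lam a u v
        = (\<integral>x. u x powr (crit_exp DIM('a) s - 1) * v x \<partial>lborel))"

end

theory Submission
  imports Defs
begin

text \<open>
  A single test function \<open>\<phi>\<close> with \<open>Q(\<phi>) < 0\<close> yields all three claims.

  To find it, let \<open>h\<close> be the Hardy constant and \<open>l > h\<close>.  The Hardy inequality with constant \<open>l\<close> fails
  for some element of the energy space, hence for some test function: by Fatou's lemma, an inequality
  valid for all test functions survives passage to limits in the space
  (\<open>test_function_above_hardy_const\<close>).  So there is a test function \<open>f\<close> with
  \<open>(f, f) < l * \<integral> f\<^sup>2 / |x|\<^sup>2\<^sup>s\<close>.  The energy and the weighted integral both scale with the power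
  \<open>N - 2 s\<close>, so concentrating or spreading \<open>f\<close> only changes where it sees the poles.  Shrunk onto the pole
  \<open>a\<^sub>i\<close>, it sees the other poles escape to infinity, and \<open>Q\<close>, rescaled, tends to
  \<open>(f, f) - \<lambda>\<^sub>i * \<integral> f\<^sup>2 / |x|\<^sup>2\<^sup>s\<close>; spread out over the whole space, it sees all poles merge at the origin,
  and \<open>\<lambda>\<^sub>i\<close> is replaced by the sum of all coefficients
  (\<open>Q_form_negative_pole\<close>, \<open>Q_form_negative_sum\<close>).

  For the nonexistence, suppose that \<open>u\<close> is a nontrivial weak solution.  Testing the equation with
  \<open>v = \<phi>\<^sup>2 / (\<epsilon> + u)\<close>, where the right-hand side contributes something nonnegative, gives
  \<open>\<integral> H u v \<le> (u, v)\<close>.  Picone's inequality \<open>(u(x) - u(y)) (v(x) - v(y)) \<le> (\<phi>(x) - \<phi>(y))\<^sup>2\<close> bounds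
  \<open>(u, v)\<close> by \<open>(\<phi>, \<phi>)\<close>, and as \<open>\<epsilon>\<close> tends to \<open>0\<close> the left-hand side tends to \<open>\<integral> H \<phi>\<^sup>2\<close>, provided that \<open>u\<close> does
  not vanish where \<open>\<phi>\<close> does not.  That proviso comes from the nonlocality of the form: the gap in Picone's
  inequality has an integral bounded uniformly in \<open>\<epsilon>\<close>, but it blows up like \<open>u(y) \<phi>(x)\<^sup>2 / \<epsilon>\<close> at every
  pair with \<open>u(x) = 0\<close>, \<open>\<phi>(x) \<noteq> 0\<close> and \<open>u(y) > 0\<close>, so such pairs form a null set.  The outcome is
  \<open>Q(\<phi>) \<ge> 0\<close> for every test function (\<open>weak_solution_Q_form_nonneg\<close>), a contradiction.

  The quotient \<open>v\<close> must be shown to lie in the completion of the test functions.  Its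
  approximants are explicit: if test functions \<open>f\<^sub>n\<close> converge to \<open>u\<close>, then the
  functions \<open>\<phi>\<^sup>2 / (\<epsilon> + sqrt (f\<^sub>n\<^sup>2 + \<delta>\<^sub>n\<^sup>2))\<close> with \<open>\<delta>\<^sub>n\<close> tending to \<open>0\<close> are again test functions, and they
  converge to \<open>v\<close> (\<open>quotient_in_D_space\<close>).
\<close>

section \<open>Smooth functions and a bump function\<close>

lemma C_k_SucI:
  assumes "\<And>x. (f has_derivative f' x) (at x)" and "\<And>b. b \<in> Basis \<Longrightarrow> C_k n (\<lambda>x. f' x b)"
  shows "C_k (Suc n) f"
proof -
  have "frechet_derivative f (at x) = f' x" for x
    using frechet_derivative_at[OF assms(1)[of x]] by simp
  then show ?thesis
    using assms by (auto simp: differentiable_def)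
qed

lemma C_k_Suc_has_derivative:
  "C_k (Suc n) f \<Longrightarrow> (f has_derivative frechet_derivative f (at x)) (at x)"
  by (simp add: frechet_derivative_works)

lemma C_k_Suc_partial:
  "C_k (Suc n) f \<Longrightarrow> b \<in> Basis \<Longrightarrow> C_k n (\<lambda>x. frechet_derivative f (at x) b)"
  by simp

lemma C_k_SucD: "C_k (Suc n) f \<Longrightarrow> C_k n f"
proof (induction n arbitrary: f)
  case 0
  then have "isCont f x" for x
    using C_k_Suc_has_derivative[OF 0] has_derivative_continuous by blast
  then show ?case by (simp add: continuous_on_eq_continuous_at)
next
  case (Suc n)
  then show ?case by (metis C_k.simps(2))
qed

lemma C_k_const [simp]: "C_k n (\<lambda>x. c)"
proof (induction n arbitrary: c)
  case (Suc n)
  show ?case by (rule C_k_SucI[where f' = "\<lambda>x h. 0"]) (auto intro: Suc)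
qed auto

lemma C_k_add: "C_k n f \<Longrightarrow> C_k n g \<Longrightarrow> C_k n (\<lambda>x. f x + g x)"
proof (induction n arbitrary: f g)
  case 0
  then show ?case by (auto intro: continuous_intros)
next
  case (Suc n)
  show ?case
    by (rule C_k_SucI[OF has_derivative_add[OF Suc.prems[THEN C_k_Suc_has_derivative]]])
      (rule Suc.IH; use Suc.prems in simp)
qed

lemma C_k_mult: "C_k n f \<Longrightarrow> C_k n g \<Longrightarrow> C_k n (\<lambda>x. f x * g x)"
proof (induction n arbitrary: f g)
  case 0
  then show ?case by (auto intro: continuous_intros)
next
  case (Suc n)
  note l = C_k_SucD[OF Suc.prems(1)] C_k_SucD[OF Suc.prems(2)]
  show ?case
    by (rule C_k_SucI[OF has_derivative_mult[OF Suc.prems[THEN C_k_Suc_has_derivative]]])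
      (intro C_k_add Suc.IH l C_k_Suc_partial Suc.prems)
qed

lemma C_k_diff: "C_k n f \<Longrightarrow> C_k n g \<Longrightarrow> C_k n (\<lambda>x. f x - g x)"
  using C_k_add[of n f "\<lambda>x. (- 1) * g x"] C_k_mult[of n "\<lambda>x. - 1" g] by simp

lemma C_k_sum: "(\<And>i. i \<in> I \<Longrightarrow> C_k n (f i)) \<Longrightarrow> C_k n (\<lambda>x. \<Sum>i\<in>I. f i x)"
  by (induction I rule: infinite_finite_induct) (auto intro: C_k_add)

lemma C_k_inner: "C_k n (\<lambda>x. x \<bullet> c)"
proof (cases n)
  case (Suc m)
  show ?thesis unfolding Suc
    by (rule C_k_SucI[where f' = "\<lambda>x h. h \<bullet> c"]) (auto intro!: derivative_eq_intros)
qed (auto intro: continuous_intros)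

text \<open>
  The derivative of \<open>1 / f\<close> is \<open>- f' / f\<^sup>2\<close>, in which \<open>1 / f\<close> itself recurs; so reciprocals gain smoothness
  by induction, and square roots, whose derivative is \<open>f' / (2 sqrt f)\<close>, gain it in the same way.
\<close>
lemma C_k_inverse: "C_k n f \<Longrightarrow> (\<And>x. f x \<noteq> 0) \<Longrightarrow> C_k n (\<lambda>x. inverse (f x))"
proof (induction n arbitrary: f)
  case 0
  then show ?case by (auto intro: continuous_intros)
next
  case (Suc n)
  note d = Suc.prems(1)[THEN C_k_Suc_has_derivative]
  have "C_k n (\<lambda>x. (- 1) * (inverse (f x) * frechet_derivative f (at x) b * inverse (f x)))"
    if "b \<in> Basis" for b
    by (intro C_k_mult C_k_const Suc.IH Suc.prems C_k_SucD[OF Suc.prems(1)]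
        C_k_Suc_partial[OF Suc.prems(1)] that)
  then show ?case
    by (intro C_k_SucI[OF Deriv.has_derivative_inverse[OF Suc.prems(2) d]]) simp
qed

lemma C_k_sqrt: "C_k n f \<Longrightarrow> (\<And>x. f x > 0) \<Longrightarrow> C_k n (\<lambda>x. sqrt (f x))"
proof (induction n arbitrary: f)
  case 0
  then show ?case by (auto intro: continuous_intros)
next
  case (Suc n)
  have "((\<lambda>x. sqrt (f x)) has_derivative
          (\<lambda>h. frechet_derivative f (at x) h * (1/2 * inverse (sqrt (f x))))) (at x)" for x
    using Suc.prems(2)[of x]
    by (auto intro!: derivative_eq_intros C_k_Suc_has_derivative[OF Suc.prems(1)]
        simp: field_simps)
  moreover have "C_k n (\<lambda>x. frechet_derivative f (at x) b * (1/2 * inverse (sqrt (f x))))"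
    if "b \<in> Basis" for b
    using Suc.prems(2)
    by (intro C_k_mult C_k_inverse Suc.IH C_k_const C_k_SucD[OF Suc.prems(1)]
        C_k_Suc_partial[OF Suc.prems(1)] that) (auto simp: less_imp_neq[symmetric])
  ultimately show ?case by (rule C_k_SucI)
qed

lemma C_k_affine: "C_k n f \<Longrightarrow> C_k n (\<lambda>x. f (c *\<^sub>R (x - t)))"
proof (induction n arbitrary: f)
  case 0
  then show ?case
    by (auto intro!: continuous_on_compose2[of UNIV f] continuous_intros)
next
  case (Suc n)
  have 1: "((\<lambda>x. f (c *\<^sub>R (x - t))) has_derivative
          (\<lambda>h. frechet_derivative f (at (c *\<^sub>R (x - t))) (c *\<^sub>R h))) (at x)" for x
    by (rule has_derivative_compose[OF _ C_k_Suc_has_derivative[OF Suc.prems]])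
      (auto intro!: derivative_eq_intros)
  have 2: "frechet_derivative f (at y) (c *\<^sub>R h) = c * frechet_derivative f (at y) h" for y h
    using linear_scale[OF has_derivative_linear[OF C_k_Suc_has_derivative[OF Suc.prems]]]
    by simp
  show ?case
    by (rule C_k_SucI[OF 1], unfold 2)
      (intro C_k_mult C_k_const Suc.IH C_k_Suc_partial[OF Suc.prems])
qed

text \<open>
  For \<open>m = 0\<close> this is the standard function that is smooth, positive for \<open>t > 0\<close> and zero for \<open>t \<le> 0\<close>.  The
  factor \<open>t\<close> to the power \<open>-m\<close> makes the family closed under differentiation, up to linear combinations.
\<close>
definition flat :: "nat \<Rightarrow> real \<Rightarrow> real" where
  "flat m t = (if t > 0 then exp (- inverse t) * inverse t ^ m else 0)"

lemma flat_deriv: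
  "(flat m has_real_derivative (flat (m + 2) t - real m * flat (m + 1) t)) (at t)"
proof -
  consider "t < 0" | "t > 0" | "t = 0" by linarith
  then show ?thesis
  proof cases
    case 1
    have "((\<lambda>t. 0) has_real_derivative 0) (at t)" by simp
    then have "(flat m has_real_derivative 0) (at t)"
      by (rule has_field_derivative_transform_within_open[where S = "{..<0}"])
        (use 1 in \<open>auto simp: flat_def\<close>)
    with 1 show ?thesis by (simp add: flat_def)
  next
    case 2
    have e: "real m * inverse t ^ (m - 1) * inverse t = real m * inverse t ^ m" by (cases m) auto
    have "((\<lambda>t. exp (- inverse t) * inverse t ^ m) has_real_derivative
        (exp (- inverse t) * (inverse t * inverse t) * inverse t ^ m
          + exp (- inverse t) * (real m * inverse t ^ (m - 1) * (- (inverse t * inverse t))))) (at t)"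
      using 2 by (auto intro!: derivative_eq_intros)
    also have "exp (- inverse t) * (inverse t * inverse t) * inverse t ^ m
          + exp (- inverse t) * (real m * inverse t ^ (m - 1) * (- (inverse t * inverse t)))
        = exp (- inverse t) * (inverse t ^ m * inverse t * inverse t
            - (real m * inverse t ^ (m - 1) * inverse t) * inverse t)"
      by (simp add: algebra_simps)
    also have "\<dots> = flat (m + 2) t - real m * flat (m + 1) t"
      unfolding e using 2 by (simp add: flat_def algebra_simps)
    finally show ?thesis
      by (rule has_field_derivative_transform_within_open[where S = "{0<..}"])
        (use 2 in \<open>auto simp: flat_def\<close>)
  next
    case 3
    \<comment> \<open>two powers beyond \<open>m\<close>: the function is then \<open>O(h\<^sup>2)\<close> at \<open>0\<close>, so its derivative there is \<open>0\<close>\<close>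
    define n where "n = m + 2"
    then have n: "n > 0" by simp
    have b: "\<bar>flat m h\<bar> \<le> real n ^ n * h\<^sup>2" for h
    proof (cases "h > 0")
      case True
      have "(1 / (real n * h)) ^ n \<le> (1 + (1 / h) / real n) ^ n"
        using True by (intro power_mono) (auto simp: n_def field_simps)
      also have "\<dots> \<le> exp (1 / h)"
        using True by (intro exp_ge_one_plus_x_over_n_power_n) (auto simp: n_def intro: order_trans[of _ 0])
      finally have "exp (- inverse h) \<le> (real n * h) ^ n"
        using True le_imp_inverse_le[of "(1 / (real n * h)) ^ n" "exp (1 / h)"] n
        by (simp add: exp_minus power_divide inverse_eq_divide)
      then have "exp (- inverse h) * inverse h ^ m \<le> (real n * h) ^ n * inverse h ^ m"
        using True by (intro mult_right_mono) auto
      also have "\<dots> = real n ^ n * h\<^sup>2"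
        using True unfolding power_mult_distrib
        by (simp add: n_def power_add power_inverse power2_eq_square)
      finally show ?thesis using True by (simp add: flat_def)
    qed (auto simp: flat_def)
    have "((\<lambda>h. (flat m (0 + h) - flat m 0) / h) \<longlongrightarrow> 0) (at 0)"
    proof (rule Lim_null_comparison)
      show "\<forall>\<^sub>F h in at 0. norm ((flat m (0 + h) - flat m 0) / h) \<le> real n ^ n * \<bar>h\<bar>"
      proof (rule always_eventually, rule allI)
        fix h :: real
        have "\<bar>flat m h\<bar> / \<bar>h\<bar> \<le> real n ^ n * h\<^sup>2 / \<bar>h\<bar>"
          by (intro divide_right_mono b) auto
        then show "norm ((flat m (0 + h) - flat m 0) / h) \<le> real n ^ n * \<bar>h\<bar>"
          by (cases "h = 0") (simp_all add: flat_def[of m 0] power2_eq_square abs_mult_self_eq[of h, symmetric] del: abs_mult_self_eq)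
      qed
      show "((\<lambda>h. real n ^ n * \<bar>h\<bar>) \<longlongrightarrow> 0) (at 0)"
        by (auto intro!: tendsto_eq_intros)
    qed
    with 3 show ?thesis by (simp add: DERIV_def flat_def[of _ 0])
  qed
qed

lemma C_k_flat: "C_k n f \<Longrightarrow> C_k n (\<lambda>x. flat m (f x))"
proof (induction n arbitrary: f m)
  case 0
  have "continuous_on UNIV (flat m)"
    using DERIV_isCont[OF flat_deriv] by (simp add: continuous_on_eq_continuous_at)
  with 0 show ?case by (auto intro: continuous_on_compose2[of UNIV "flat m"])
next
  case (Suc n)
  have "((\<lambda>x. flat m (f x)) has_derivative
      (\<lambda>h. frechet_derivative f (at x) h * (flat (m + 2) (f x) - real m * flat (m + 1) (f x)))) (at x)"
    for x
    using has_derivative_compose[OF C_k_Suc_has_derivative[OF Suc.prems]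
        flat_deriv[THEN has_field_derivative_imp_has_derivative]]
    by (simp add: mult.commute)
  then show ?case
    by (rule C_k_SucI)
      (intro C_k_mult C_k_diff Suc.IH C_k_const C_k_SucD[OF Suc.prems] C_k_Suc_partial[OF Suc.prems])
qed

lemma Cc_infinity_iff:
  "f \<in> Cc_infinity \<longleftrightarrow> (\<forall>n. C_k n f) \<and> (\<exists>R>0. \<forall>x. norm x > R \<longrightarrow> f x = 0)"
proof -
  have "bounded {x. f x \<noteq> 0} \<longleftrightarrow> (\<exists>R>0. \<forall>x. norm x > R \<longrightarrow> f x = 0)"
    by (auto simp: bounded_pos not_less[symmetric])
  then show ?thesis by (auto simp: Cc_infinity_def)
qed

text \<open>
  Without a nonzero test function the Hardy inequality would hold trivially with every constant, and
  there would be no best one.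
\<close>
lemma Cc_infinity_bump: "(\<lambda>x::'a::euclidean_space. flat 0 (1 - x \<bullet> x)) \<in> Cc_infinity"
proof -
  have "C_k n (\<lambda>x::'a. flat 0 (1 - (\<Sum>b\<in>Basis. (x \<bullet> b) * (x \<bullet> b))))" for n
    by (intro C_k_flat C_k_diff C_k_sum C_k_mult C_k_inner C_k_const)
  moreover have "flat 0 (1 - x \<bullet> x) = 0" if "norm x > 1" for x :: 'a
    using that power_strict_mono[of 1 "norm x" 2] by (simp add: flat_def dot_square_norm not_less)
  ultimately show ?thesis
    unfolding Cc_infinity_iff by (auto simp: euclidean_inner[symmetric] intro!: exI[of _ 1])
qed

lemma Cc_infinity_continuous: "f \<in> Cc_infinity \<Longrightarrow> continuous_on UNIV f"
  unfolding Cc_infinity_iff by (metis C_k.simps(1))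

lemma Cc_infinity_bounded:
  assumes "f \<in> Cc_infinity" obtains M where "M > 0" "\<And>x. \<bar>f x\<bar> \<le> M"
proof -
  obtain R where R: "\<And>x. norm x > R \<Longrightarrow> f x = 0"
    using assms unfolding Cc_infinity_iff by blast
  have "bounded (f ` cball 0 R)"
    using assms by (intro compact_imp_bounded compact_continuous_image
        continuous_on_subset[OF Cc_infinity_continuous]) auto
  then obtain M where "M > 0" "\<And>x. norm x \<le> R \<Longrightarrow> \<bar>f x\<bar> \<le> M"
    by (auto simp: bounded_pos)
  with R show ?thesis
    by (metis abs_zero less_imp_le not_less that)
qed

lemma Cc_infinity_Lipschitz_on_cball:
  assumes "f \<in> Cc_infinity"
  obtains L where "L > 0" "\<And>x y. norm x \<le> R \<Longrightarrow> norm y \<le> R \<Longrightarrow> \<bar>f x - f y\<bar> \<le> L * norm (x - y)"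
proof -
  let ?d = "\<lambda>x. frechet_derivative f (at x)"
  have C: "C_k (Suc 0) f" using assms unfolding Cc_infinity_iff by blast
  have "\<exists>B>0. \<forall>x. norm x \<le> R \<longrightarrow> \<bar>?d x b\<bar> \<le> B" if "b \<in> Basis" for b
  proof -
    have "bounded ((\<lambda>x. ?d x b) ` cball 0 R)"
      using C_k_Suc_partial[OF C that]
      by (intro compact_imp_bounded compact_continuous_image) (auto intro: continuous_on_subset)
    then show ?thesis by (auto simp: bounded_pos)
  qed
  then obtain B where B: "\<And>b. b \<in> Basis \<Longrightarrow> B b > 0"
      "\<And>b x. b \<in> Basis \<Longrightarrow> norm x \<le> R \<Longrightarrow> \<bar>?d x b\<bar> \<le> B b" by metis
  define L where "L = 1 + (\<Sum>b\<in>Basis. B b)"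
  have on: "onorm (?d x) \<le> L" if "norm x \<le> R" for x
  proof (rule onorm_le)
    fix h
    have lin: "linear (?d x)"
      using C_k_Suc_has_derivative[OF C] has_derivative_linear by blast
    have "?d x h = ?d x (\<Sum>b\<in>Basis. (h \<bullet> b) *\<^sub>R b)" by (simp add: euclidean_representation)
    also have "\<dots> = (\<Sum>b\<in>Basis. (h \<bullet> b) * ?d x b)"
      by (simp add: linear_sum[OF lin] linear_scale[OF lin])
    finally have "norm (?d x h) \<le> (\<Sum>b\<in>Basis. \<bar>(h \<bullet> b) * ?d x b\<bar>)" by simp
    also have "\<dots> \<le> (\<Sum>b\<in>Basis. norm h * B b)"
      unfolding abs_mult using B that by (intro sum_mono mult_mono) (auto intro: Basis_le_norm)
    also have "\<dots> \<le> L * norm h"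
      unfolding L_def sum_distrib_left[symmetric] by (simp add: algebra_simps)
    finally show "norm (?d x h) \<le> L * norm h" .
  qed
  show ?thesis
  proof (rule that)
    show "L > 0" using sum_nonneg[of Basis B] B(1) by (force simp: L_def)
    fix x y :: 'a assume "norm x \<le> R" "norm y \<le> R"
    then show "\<bar>f x - f y\<bar> \<le> L * norm (x - y)"
      using differentiable_bound[of "cball 0 R" f ?d L x y]
        has_derivative_at_withinI[OF C_k_Suc_has_derivative[OF C]] on
      by (auto simp: dist_norm)
  qed
qed

section \<open>Power weights near the origin and at infinity\<close>

lemma cball_in_borel [measurable]: "cball c r \<in> sets borel"
  by simp

lemma nn_integral_lborel_affine:
  fixes f :: "'a::euclidean_space \<Rightarrow> ennreal"
  assumes [measurable]: "f \<in> borel_measurable borel" and c: "c \<noteq> 0"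
  shows "(\<integral>\<^sup>+x. f x \<partial>lborel) = ennreal (\<bar>c\<bar> ^ DIM('a)) * (\<integral>\<^sup>+x. f (t + c *\<^sub>R x) \<partial>lborel)"
  by (subst lborel_affine[OF c, of t])
    (simp add: nn_integral_density nn_integral_distr nn_integral_cmult)

lemma lborel_integral_affine:
  fixes f :: "'a::euclidean_space \<Rightarrow> real"
  assumes [measurable]: "f \<in> borel_measurable borel" and c: "c \<noteq> 0"
  shows "(\<integral>x. f x \<partial>lborel) = \<bar>c\<bar> ^ DIM('a) * (\<integral>x. f (t + c *\<^sub>R x) \<partial>lborel)"
  by (subst lborel_affine[OF c, of t]) (simp add: integral_density integral_distr)

text \<open>
  The function is bounded by the sum over \<open>j\<close> of \<open>C b^j\<close> times the indicator of the ball of radius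
  \<open>r^j\<close>, whose integral is a geometric series.  With \<open>r < 1\<close> this controls a singularity at the
  origin, with \<open>r > 1\<close> the decay at infinity.
\<close>
lemma nn_integral_dyadic_finite:
  fixes f :: "'a::euclidean_space \<Rightarrow> real"
  assumes r: "r > 0" and b: "b \<ge> 0" "b * r ^ DIM('a) < 1" and C: "C \<ge> 0"
    and f: "\<And>x. f x > 0 \<Longrightarrow> \<exists>j::nat. norm x \<le> r ^ j \<and> f x \<le> C * b ^ j"
  shows "(\<integral>\<^sup>+x. ennreal (f x) \<partial>lborel) < \<infinity>"
proof -
  let ?V = "unit_ball_vol (real DIM('a))"
  have "(\<integral>\<^sup>+x. ennreal (f x) \<partial>lborel)
      \<le> (\<integral>\<^sup>+x. (\<Sum>j. ennreal (C * b ^ j) * indicator (cball (0::'a) (r ^ j)) x) \<partial>lborel)"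
  proof (rule nn_integral_mono)
    fix x :: 'a
    show "ennreal (f x) \<le> (\<Sum>j. ennreal (C * b ^ j) * indicator (cball (0::'a) (r ^ j)) x)"
    proof (cases "f x > 0")
      case True
      from f[OF True] obtain j where j: "norm x \<le> r ^ j" "f x \<le> C * b ^ j" by blast
      have "ennreal (f x) \<le> (\<Sum>i\<in>{j}. ennreal (C * b ^ i) * indicator (cball (0::'a) (r ^ i)) x)"
        using j by (auto intro: ennreal_leI)
      also have "\<dots> \<le> (\<Sum>j. ennreal (C * b ^ j) * indicator (cball (0::'a) (r ^ j)) x)"
        by (rule sum_le_suminf) auto
      finally show ?thesis .
    qed (simp add: ennreal_neg)
  qed
  also have "\<dots> = (\<Sum>j. ennreal (C * b ^ j) * emeasure lborel (cball (0::'a) (r ^ j)))"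
    by (subst nn_integral_suminf, measurable) (simp add: nn_integral_cmult_indicator)
  also have "\<dots> = (\<Sum>j. ennreal ((C * ?V) * (b * r ^ DIM('a)) ^ j))"
  proof (intro suminf_cong)
    fix j
    have "emeasure lborel (cball (0::'a) (r ^ j)) = ennreal (?V * (r ^ j) ^ DIM('a))"
      using r by (intro emeasure_cball) auto
    moreover have "(r ^ j) ^ DIM('a) = (r ^ DIM('a)) ^ j"
      by (metis mult.commute power_mult)
    ultimately show "ennreal (C * b ^ j) * emeasure lborel (cball (0::'a) (r ^ j))
        = ennreal ((C * ?V) * (b * r ^ DIM('a)) ^ j)"
      using r b C by (simp add: ennreal_mult[symmetric] power_mult_distrib mult_ac)
  qed
  also have "\<dots> = ennreal (\<Sum>j. (C * ?V) * (b * r ^ DIM('a)) ^ j)"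
    using r b C by (intro suminf_ennreal2 summable_mult summable_geometric) auto
  also have "\<dots> < \<infinity>" by simp
  finally show ?thesis .
qed

lemma two_power_powr: "((2::real) ^ j) powr p = (2 powr p) ^ j"
  by (subst powr_realpow[symmetric]) (simp_all add: powr_powr powr_power mult.commute)

lemma nn_integral_powr_local:
  fixes p :: real
  assumes "0 \<le> p" "p < real DIM('a::euclidean_space)"
  shows "(\<integral>\<^sup>+x. ennreal (indicator (cball (0::'a) 1) x / norm x powr p) \<partial>lborel) < \<infinity>"
proof (rule nn_integral_dyadic_finite[where r = "1/2" and b = "2 powr p" and C = "2 powr p"])
  have "2 powr p * (1/2) ^ DIM('a) = 2 powr (p - real DIM('a))"
    by (simp add: powr_diff powr_realpow power_divide)
  also have "\<dots> < 1" using assms by (simp add: powr_less_one)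
  finally show "2 powr p * (1/2) ^ DIM('a) < 1" .
next
  fix x :: 'a assume "indicator (cball (0::'a) 1) x / norm x powr p > 0"
  then have x: "0 < norm x" "norm x \<le> 1"
    by (cases "x = 0"; cases "norm x \<le> 1"; simp)+
  obtain n :: nat where "(1/2) ^ n < norm x"
    using real_arch_pow_inv[OF x(1), of "1/2"] by auto
  then obtain j where j: "\<not> (1/2) ^ j < norm x" "(1/2) ^ Suc j < norm x"
    using ex_least_nat_less[of "\<lambda>n. (1/2) ^ n < norm x" n] x by (auto simp: less_Suc_eq_le)
  have "1 / norm x powr p \<le> 1 / ((1/2) ^ Suc j) powr p"
    using j(2) x assms by (intro divide_left_mono powr_mono2 mult_pos_pos) auto
  also have "1 / ((1/2::real) ^ Suc j) powr p = 2 powr p * (2 powr p) ^ j"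
  proof -
    have "((1/2::real) ^ Suc j) powr p * (2 ^ Suc j) powr p = 1"
      by (subst powr_mult[symmetric]) (simp_all add: power_mult_distrib[symmetric] del: power_Suc)
    then have "1 / ((1/2::real) ^ Suc j) powr p = (2 ^ Suc j) powr p"
      by (simp add: field_simps)
    also have "\<dots> = (2 powr p) ^ Suc j"
      by (rule two_power_powr)
    finally show ?thesis by simp
  qed
  finally show "\<exists>j. norm x \<le> (1/2) ^ j \<and> indicator (cball (0::'a) 1) x / norm x powr p
      \<le> 2 powr p * (2 powr p) ^ j"
    using j x by (intro exI[of _ j]) simp
qed auto

lemma nn_integral_powr_local_radius:
  fixes p R :: real
  assumes "0 \<le> p" "p < real DIM('a::euclidean_space)"
  shows "(\<integral>\<^sup>+x. ennreal (indicator (cball (0::'a) R) x / norm x powr p) \<partial>lborel) < \<infinity>"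
proof -
  have "(\<integral>\<^sup>+x. ennreal (indicator (cball (0::'a) R) x / norm x powr p) \<partial>lborel)
    \<le> (\<integral>\<^sup>+x. ennreal (indicator (cball (0::'a) 1) x / norm x powr p) + indicator (cball 0 R) x \<partial>lborel)"
  proof (intro nn_integral_mono)
    fix x :: 'a
    have "1 / norm x powr p \<le> 1" if "norm x > 1"
      using ge_one_powr_ge_zero[of "norm x" p] that assms by (simp add: divide_le_eq_1)
    then show "ennreal (indicator (cball (0::'a) R) x / norm x powr p)
      \<le> ennreal (indicator (cball (0::'a) 1) x / norm x powr p) + indicator (cball 0 R) x"
      by (auto simp: indicator_def)
  qed
  also have "\<dots> = (\<integral>\<^sup>+x. ennreal (indicator (cball (0::'a) 1) x / norm x powr p) \<partial>lborel)
      + emeasure lborel (cball (0::'a) R)"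
    by (subst nn_integral_add[OF _ borel_measurable_indicator], measurable)
  also have "\<dots> < \<infinity>"
    using nn_integral_powr_local[OF assms] emeasure_lborel_cball_finite[of "0::'a" R] by simp
  finally show ?thesis .
qed

lemma nn_integral_powr_infinity:
  fixes p :: real
  assumes "p > real DIM('a::euclidean_space)"
  shows "(\<integral>\<^sup>+x. ennreal (indicator (- cball (0::'a) 1) x / norm x powr p) \<partial>lborel) < \<infinity>"
proof (rule nn_integral_dyadic_finite[where r = 2 and b = "2 powr (- p)" and C = "2 powr p"])
  have "2 powr (- p) * 2 ^ DIM('a) = 2 powr (real DIM('a) - p)"
    by (simp add: powr_diff powr_minus powr_realpow divide_inverse)
  also have "\<dots> < 1" using assms by (simp add: powr_less_one)
  finally show "2 powr (- p) * 2 ^ DIM('a) < 1" .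
next
  fix x :: 'a assume "indicator (- cball (0::'a) 1) x / norm x powr p > 0"
  then have x: "norm x > 1"
    by (cases "norm x \<le> 1") simp_all
  obtain n :: nat where "norm x < 2 ^ n"
    using real_arch_pow[of 2 "norm x"] by auto
  then obtain j where j: "\<not> norm x \<le> 2 ^ j" "norm x \<le> 2 ^ Suc j"
    using ex_least_nat_less[of "\<lambda>n. norm x \<le> 2 ^ n" n] x by (auto simp: less_Suc_eq_le)
  have "1 / norm x powr p \<le> 1 / (2 ^ j) powr p"
    using j(1) x assms by (intro divide_left_mono powr_mono2 mult_pos_pos) auto
  also have "1 / ((2::real) ^ j) powr p = 2 powr p * (2 powr (- p)) ^ Suc j"
  proof -
    show ?thesis by (simp add: two_power_powr powr_minus power_inverse power_divide inverse_eq_divide)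
  qed
  finally show "\<exists>j. norm x \<le> 2 ^ j \<and> indicator (- cball (0::'a) 1) x / norm x powr p
      \<le> 2 powr p * (2 powr (- p)) ^ j"
    using j x by (intro exI[of _ "Suc j"]) simp
qed auto

section \<open>The Gagliardo energy\<close>

definition jump :: "('a \<Rightarrow> real) \<Rightarrow> 'a \<times> 'a \<Rightarrow> real" where
  "jump u z = u (fst z) - u (snd z)"

text \<open>
  With the singular kernel absorbed into a measure, the scalar product of the energy space becomes,
  up to its constant, the \<open>L\<^sup>2\<close> product of the increments \<open>jump u\<close> and \<open>jump v\<close>.
\<close>
definition pairs :: "real \<Rightarrow> ('a::euclidean_space \<times> 'a) measure" where
  "pairs s = density (lborel \<Otimes>\<^sub>M lborel)
     (\<lambda>z. ennreal (1 / norm (fst z - snd z) powr (real DIM('a) + 2 * s)))"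

text \<open>
  The squared norm up to the factor \<open>C / 2\<close>, but with values in \<open>[0, \<infinity>]\<close>, so that a divergent integral is not
  mistaken for a vanishing one.
\<close>
definition energy :: "real \<Rightarrow> ('a::euclidean_space \<Rightarrow> real) \<Rightarrow> ennreal" where
  "energy s u = (\<integral>\<^sup>+z. ennreal ((jump u z)\<^sup>2) \<partial>pairs s)"

lemma sets_pairs [measurable_cong]: "sets (pairs s) = sets (borel \<Otimes>\<^sub>M borel)"
  by (simp add: pairs_def cong: sets_pair_measure_cong)

lemma jump_measurable [measurable (raw)]:
  assumes [measurable]: "u \<in> borel_measurable borel"
  shows "jump u \<in> borel_measurable (borel \<Otimes>\<^sub>M borel)"
  unfolding jump_def by measurable

lemma jump_diff: "jump (\<lambda>x. u x - v x) z = jump u z - jump v z"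
  by (simp add: jump_def)

lemma AE_pairs:
  assumes "AE x in lborel. P x" shows "AE z in pairs s. P (fst z) \<and> P (snd z)"
proof -
  obtain N where N: "{x. \<not> P x} \<subseteq> N" "emeasure lborel N = 0" "N \<in> sets borel"
    using AE_E[OF assms] by auto
  then have [measurable]: "N \<in> sets borel" by simp
  have "AE x in lborel. x \<notin> N"
    using N by (intro AE_I[of _ _ N]) auto
  then have "AE x in lborel. AE y in lborel. fst (x, y) \<notin> N \<and> snd (x, y) \<notin> N"
    by auto
  then have "AE z in lborel \<Otimes>\<^sub>M lborel. fst z \<notin> N \<and> snd z \<notin> N"
    by (intro lborel_pair.AE_pair_measure) measurable
  then show ?thesis
    unfolding pairs_def using N by (subst AE_density) auto
qed

lemma D_inner_eq:
  fixes u v :: "'a::euclidean_space \<Rightarrow> real"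
  assumes [measurable]: "u \<in> borel_measurable borel" "v \<in> borel_measurable borel"
  shows "D_inner s u v = C_const DIM('a) s / 2 * (\<integral>z. jump u z * jump v z \<partial>pairs s)"
  unfolding D_inner_def pairs_def
  by (subst integral_density) (auto simp: jump_def case_prod_unfold)

lemma C_const_pos: "0 < s \<Longrightarrow> s < 1 \<Longrightarrow> C_const N s > 0"
  unfolding C_const_def by (intro mult_pos_pos divide_pos_pos Gamma_real_pos) auto

lemma integrable_jump_mult:
  assumes [measurable]: "u \<in> borel_measurable borel" "v \<in> borel_measurable borel"
    and "energy s u < \<infinity>" "energy s v < \<infinity>"
  shows "integrable (pairs s) (\<lambda>z. jump u z * jump v z)"
proof -
  have sq: "integrable (pairs s) (\<lambda>z. (jump w z)\<^sup>2)"
    if [measurable]: "w \<in> borel_measurable borel" and "energy s w < \<infinity>" for w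
    using that(2) by (intro integrableI_nonneg) (auto simp: energy_def)
  show ?thesis
  proof (rule Bochner_Integration.integrable_bound)
    show "integrable (pairs s) (\<lambda>z. (jump u z)\<^sup>2 + (jump v z)\<^sup>2)"
      by (intro Bochner_Integration.integrable_add sq assms)
    have "\<bar>p * q\<bar> \<le> p\<^sup>2 + q\<^sup>2" for p q :: real
    proof -
      have "2 * (\<bar>p\<bar> * \<bar>q\<bar>) \<le> p\<^sup>2 + q\<^sup>2"
        using sum_squares_bound[of "\<bar>p\<bar>" "\<bar>q\<bar>"] by simp
      moreover have "0 \<le> \<bar>p\<bar> * \<bar>q\<bar>" by simp
      ultimately show ?thesis unfolding abs_mult by linarith
    qed
    then show "AE z in pairs s. norm (jump u z * jump v z) \<le> norm ((jump u z)\<^sup>2 + (jump v z)\<^sup>2)"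
      by (auto intro!: always_eventually)
  qed measurable
qed

lemma D_inner_self:
  fixes u :: "'a::euclidean_space \<Rightarrow> real"
  assumes [measurable]: "u \<in> borel_measurable borel" and "0 < s" "s < 1"
  shows "D_inner s u u = C_const DIM('a) s / 2 * enn2real (energy s u)"
  using assms(1) by (subst D_inner_eq) (auto simp: energy_def integral_eq_nn_integral power2_eq_square)

lemma D_norm_sq:
  fixes u :: "'a::euclidean_space \<Rightarrow> real"
  assumes [measurable]: "u \<in> borel_measurable borel" and "0 < s" "s < 1"
  shows "(D_norm s u)\<^sup>2 = D_inner s u u"
  using C_const_pos[of s "DIM('a)"] assms(2,3) by (simp add: D_norm_def D_inner_self[OF assms])

lemma energy_mono_AE:
  "(AE z in pairs s. (jump u z)\<^sup>2 \<le> f z) \<Longrightarrow> energy s u \<le> (\<integral>\<^sup>+z. ennreal (f z) \<partial>pairs s)"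
  unfolding energy_def by (intro nn_integral_mono_AE) (auto intro: ennreal_leI)

lemma energy_diff_commute: "energy s (\<lambda>x. u x - v x) = energy s (\<lambda>x. v x - u x)"
  unfolding energy_def by (simp add: jump_diff power2_commute)

text \<open>
  Cauchy's inequality with a free parameter: a small \<open>e\<close> makes the coefficient of the limit \<open>v\<close> nearly
  \<open>1\<close>, which is what passing to the limit in an inequality with sharp constants requires.
\<close>
lemma energy_triangle:
  assumes [measurable]: "u \<in> borel_measurable borel" "v \<in> borel_measurable borel" and "e > 0"
  shows "energy s u \<le> ennreal (1 + e) * energy s v + ennreal (1 + 1 / e) * energy s (\<lambda>x. u x - v x)"
proof -
  have e: "(p + q)\<^sup>2 \<le> (1 + e) * p\<^sup>2 + (1 + 1 / e) * q\<^sup>2" for p q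
  proof -
    have "(1 + e) * p\<^sup>2 + (1 + 1 / e) * q\<^sup>2 - (p + q)\<^sup>2 = (e * p - q)\<^sup>2 / e"
      using \<open>e > 0\<close> by (simp add: field_simps power2_eq_square)
    also have "\<dots> \<ge> 0" using \<open>e > 0\<close> by simp
    finally show ?thesis by simp
  qed
  have "energy s u \<le> (\<integral>\<^sup>+z. ennreal ((1 + e) * (jump v z)\<^sup>2 + (1 + 1 / e) * (jump (\<lambda>x. u x - v x) z)\<^sup>2) \<partial>pairs s)"
    using e[of "jump v z" "jump u z - jump v z" for z]
    by (intro energy_mono_AE) (simp add: jump_diff)
  also have "\<dots> = (\<integral>\<^sup>+z. ennreal (1 + e) * ennreal ((jump v z)\<^sup>2)
      + ennreal (1 + 1 / e) * ennreal ((jump (\<lambda>x. u x - v x) z)\<^sup>2) \<partial>pairs s)"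
    using \<open>e > 0\<close> by (simp add: ennreal_mult[symmetric] ennreal_plus[symmetric] del: ennreal_plus)
  also have "\<dots> = ennreal (1 + e) * energy s v + ennreal (1 + 1 / e) * energy s (\<lambda>x. u x - v x)"
    unfolding energy_def by (simp add: nn_integral_add nn_integral_cmult)
  finally show ?thesis .
qed

lemma energy_Fatou:
  fixes u :: "'a::euclidean_space \<Rightarrow> real"
  assumes [measurable]: "\<And>n. f n \<in> borel_measurable borel"
    and lim: "AE x in lborel. (\<lambda>n. f n x) \<longlonglongrightarrow> u x"
  shows "energy s u \<le> liminf (\<lambda>n. energy s (f n))"
proof -
  have "energy s u = (\<integral>\<^sup>+z. liminf (\<lambda>n. ennreal ((jump (f n) z)\<^sup>2)) \<partial>pairs s)"
    unfolding energy_def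
  proof (rule nn_integral_cong_AE, use AE_pairs[OF lim] in eventually_elim)
    case (elim z)
    then have "(\<lambda>n. ennreal ((jump (f n) z)\<^sup>2)) \<longlonglongrightarrow> ennreal ((jump u z)\<^sup>2)"
      unfolding jump_def by (intro tendsto_intros) auto
    then show ?case by (intro lim_imp_Liminf[symmetric]) simp_all
  qed
  also have "\<dots> \<le> liminf (\<lambda>n. energy s (f n))"
    unfolding energy_def by (intro nn_integral_liminf) measurable
  finally show ?thesis .
qed

lemma Cc_infinity_measurable [measurable_dest]: "f \<in> Cc_infinity \<Longrightarrow> f \<in> borel_measurable borel"
  by (intro borel_measurable_continuous_onI Cc_infinity_continuous)

text \<open>
  The Lipschitz bound tames the kernel near the diagonal, because \<open>2 - 2 s > 0\<close>; boundedness suffices far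
  from it, because \<open>2 s > 0\<close>; and one of the two points has to lie in the support.
\<close>
lemma energy_Cc_infinity_finite:
  fixes f :: "'a::euclidean_space \<Rightarrow> real"
  assumes s: "0 < s" "s < 1" and f: "f \<in> Cc_infinity"
  shows "energy s f < \<infinity>"
proof -
  let ?d = "real DIM('a) + 2 * s"
  let ?B = "\<lambda>R. cball (0::'a) R"
  obtain R where R: "R > 0" "\<And>x. norm x > R \<Longrightarrow> f x = 0"
    using f unfolding Cc_infinity_iff by blast
  obtain M where M: "M > 0" "\<And>x. \<bar>f x\<bar> \<le> M" using Cc_infinity_bounded[OF f] by blast
  obtain L where L: "L > 0"
      "\<And>x y. norm x \<le> R + 1 \<Longrightarrow> norm y \<le> R + 1 \<Longrightarrow> \<bar>f x - f y\<bar> \<le> L * norm (x - y)"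
    using Cc_infinity_Lipschitz_on_cball[OF f, of "R + 1"] by blast
  \<comment> \<open>the exponent \<open>N + 2 s - 2\<close> is negative if \<open>N = 1\<close> and \<open>s < 1/2\<close>; raising it to \<open>0\<close> is harmless on the unit ball\<close>
  define p where "p = max 0 (?d - 2)"
  have p: "0 \<le> p" "p < real DIM('a)" using s by (auto simp: p_def)
  define k1 :: "'a \<Rightarrow> real" where "k1 z = indicator (?B 1) z / norm z powr p" for z
  define k2 :: "'a \<Rightarrow> real" where "k2 z = indicator (- ?B 1) z / norm z powr ?d" for z
  define k where "k z = L\<^sup>2 * k1 z + (2 * M)\<^sup>2 * k2 z" for z
  have k12: "k1 z \<ge> 0" "k2 z \<ge> 0" for z by (auto simp: k1_def k2_def)
  then have k0: "k z \<ge> 0" for z by (simp add: k_def)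
  have [measurable]: "k1 \<in> borel_measurable borel" "k2 \<in> borel_measurable borel"
    unfolding k1_def k2_def by measurable
  then have [measurable]: "k \<in> borel_measurable borel" unfolding k_def by measurable
  have [measurable]: "f \<in> borel_measurable borel" by (rule Cc_infinity_measurable[OF f])
  have K: "(\<integral>\<^sup>+z. ennreal (k z) \<partial>lborel) < \<infinity>"
  proof -
    have "(\<integral>\<^sup>+z. ennreal (k z) \<partial>lborel) = ennreal (L\<^sup>2) * (\<integral>\<^sup>+z. ennreal (k1 z) \<partial>lborel)
      + ennreal ((2 * M)\<^sup>2) * (\<integral>\<^sup>+z. ennreal (k2 z) \<partial>lborel)"
      unfolding k_def using k12 by (simp add: ennreal_mult' nn_integral_add nn_integral_cmult)
    also have "\<dots> < \<infinity>"
      using nn_integral_powr_local[OF p] nn_integral_powr_infinity[where 'a = 'a and p = ?d] s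
      unfolding k1_def[symmetric] k2_def[symmetric] by (simp add: ennreal_mult_less_top)
    finally show ?thesis .
  qed
  have near: "(f x - f y)\<^sup>2 / norm (x - y) powr ?d \<le> k (x - y)" if "norm x \<le> R" for x y
  proof (cases "norm (x - y) \<le> 1")
    case True
    have "norm y \<le> R + 1" using that True norm_triangle_sub[of y x] by (simp add: norm_minus_commute)
    then have "(f x - f y)\<^sup>2 \<le> (L * norm (x - y))\<^sup>2"
      using L that by (intro abs_le_square_iff[THEN iffD1]) auto
    then have "(f x - f y)\<^sup>2 / norm (x - y) powr ?d \<le> L\<^sup>2 * (norm (x - y) powr 2 / norm (x - y) powr ?d)"
      by (simp add: divide_right_mono power_mult_distrib)
    also have "norm (x - y) powr 2 / norm (x - y) powr ?d \<le> 1 / norm (x - y) powr p"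
    proof (cases "x = y")
      case False
      then have "norm (x - y) powr 2 / norm (x - y) powr ?d = norm (x - y) powr (2 - ?d)"
        by (simp add: powr_diff)
      also have "\<dots> \<le> norm (x - y) powr (- p)"
        using True False by (intro powr_mono') (auto simp: p_def)
      finally show ?thesis by (simp add: powr_minus_divide)
    qed auto
    finally show ?thesis using True L by (simp add: k_def k1_def k2_def)
  next
    case False
    have "(f x - f y)\<^sup>2 \<le> (2 * M)\<^sup>2"
      using M(2)[of x] M(2)[of y] by (intro abs_le_square_iff[THEN iffD1]) auto
    then show ?thesis using False by (simp add: k_def k1_def k2_def divide_right_mono)
  qed
  have bound: "(f x - f y)\<^sup>2 / norm (x - y) powr ?d
      \<le> indicator (?B R) x * k (x - y) + indicator (?B R) y * k (y - x)" for x y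
  proof -
    consider "norm x \<le> R" | "norm y \<le> R" | "norm x > R" "norm y > R" by linarith
    then show ?thesis
    proof cases
      case 1
      then show ?thesis using near[of x y] k0 by (auto simp: indicator_def add_increasing2)
    next
      case 2
      then show ?thesis using near[of y x] k0
        by (auto simp: indicator_def add_increasing power2_commute norm_minus_commute)
    next
      case 3
      then show ?thesis using R k0 by (auto simp: indicator_def)
    qed
  qed
  have trans1: "(\<integral>\<^sup>+y. ennreal (indicator (?B R) x * k (x - y)) \<partial>lborel)
      = indicator (?B R) x * (\<integral>\<^sup>+z. ennreal (k z) \<partial>lborel)" for x
    by (subst (2) nn_integral_lborel_affine[of _ "-1" x])
      (auto simp: ennreal_mult' nn_integral_cmult ennreal_indicator)
  have "energy s f = (\<integral>\<^sup>+z. ennreal ((f (fst z) - f (snd z))\<^sup>2 / norm (fst z - snd z) powr ?d) \<partial>(lborel \<Otimes>\<^sub>M lborel))"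
    unfolding energy_def pairs_def jump_def
    by (subst nn_integral_density) (auto simp: ennreal_mult'[symmetric])
  also have "\<dots> \<le> (\<integral>\<^sup>+z. ennreal (indicator (?B R) (fst z) * k (fst z - snd z))
      + ennreal (indicator (?B R) (snd z) * k (snd z - fst z)) \<partial>(lborel \<Otimes>\<^sub>M lborel))"
    by (intro nn_integral_mono) (auto simp: ennreal_plus[symmetric] k0 simp del: ennreal_plus intro!: ennreal_leI bound)
  also have "\<dots> = (\<integral>\<^sup>+z. ennreal (indicator (?B R) (fst z) * k (fst z - snd z)) \<partial>(lborel \<Otimes>\<^sub>M lborel))
      + (\<integral>\<^sup>+z. ennreal (indicator (?B R) (snd z) * k (snd z - fst z)) \<partial>(lborel \<Otimes>\<^sub>M lborel))"
    by (subst nn_integral_add) auto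
  also have "(\<integral>\<^sup>+z. ennreal (indicator (?B R) (fst z) * k (fst z - snd z)) \<partial>(lborel \<Otimes>\<^sub>M lborel))
      = (\<integral>\<^sup>+x. \<integral>\<^sup>+y. ennreal (indicator (?B R) x * k (x - y)) \<partial>lborel \<partial>lborel)"
    by (subst lborel.nn_integral_fst[symmetric]) auto
  also have "(\<integral>\<^sup>+z. ennreal (indicator (?B R) (snd z) * k (snd z - fst z)) \<partial>(lborel \<Otimes>\<^sub>M lborel))
      = (\<integral>\<^sup>+x. \<integral>\<^sup>+y. ennreal (indicator (?B R) x * k (x - y)) \<partial>lborel \<partial>lborel)"
    by (subst lborel_pair.nn_integral_snd[symmetric]) auto
  also have "(\<integral>\<^sup>+x. \<integral>\<^sup>+y. ennreal (indicator (?B R) x * k (x - y)) \<partial>lborel \<partial>lborel)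
      = emeasure lborel (?B R) * (\<integral>\<^sup>+z. ennreal (k z) \<partial>lborel)"
    unfolding trans1 by (subst nn_integral_multc) auto
  finally show ?thesis
    using K emeasure_lborel_cball_finite[of "0::'a" R] 
    by (auto simp: ennreal_mult_less_top order_le_less_trans)
qed

section \<open>The energy space and the Hardy constant\<close>

lemma Cc_infinity_diff:
  assumes "f \<in> Cc_infinity" "g \<in> Cc_infinity" shows "(\<lambda>x. f x - g x) \<in> Cc_infinity"
proof -
  obtain R S where "\<And>x. norm x > R \<Longrightarrow> f x = 0" "\<And>x. norm x > S \<Longrightarrow> g x = 0" "R > 0"
    using assms unfolding Cc_infinity_iff by blast
  then have "\<forall>x. norm x > max R S \<longrightarrow> f x - g x = 0" "max R S > 0" by auto
  moreover have "C_k n (\<lambda>x. f x - g x)" for n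
    using assms by (auto simp: Cc_infinity_iff intro: C_k_diff)
  ultimately show ?thesis unfolding Cc_infinity_iff by blast
qed

lemma D_space_measurable [measurable_dest]: "u \<in> D_space s \<Longrightarrow> u \<in> borel_measurable borel"
  by (simp add: D_space_def)

lemma D_norm_less_iff:
  fixes u :: "'a::euclidean_space \<Rightarrow> real"
  assumes [measurable]: "u \<in> borel_measurable borel" and s: "0 < s" "s < 1"
    and fin: "energy s u < \<infinity>" and e: "e > 0"
  shows "D_norm s u < e \<longleftrightarrow> energy s u < ennreal (2 * e\<^sup>2 / C_const DIM('a) s)"
proof -
  obtain r where r: "energy s u = ennreal r" "r \<ge> 0" using fin by (cases "energy s u") auto
  have "D_norm s u = sqrt (C_const DIM('a) s / 2 * r)"
    using r by (simp add: D_norm_def D_inner_self s)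
  then have "D_norm s u < e \<longleftrightarrow> sqrt (C_const DIM('a) s / 2 * r) < sqrt (e\<^sup>2)"
    using e by simp
  also have "\<dots> \<longleftrightarrow> C_const DIM('a) s / 2 * r < e\<^sup>2" by (rule real_sqrt_less_iff)
  also have "\<dots> \<longleftrightarrow> r < 2 * e\<^sup>2 / C_const DIM('a) s"
    using C_const_pos[OF s, of "DIM('a)"] by (simp add: field_simps)
  finally show ?thesis using r by (simp add: ennreal_less_iff)
qed

lemma ennreal_tendsto_zeroI:
  fixes f :: "nat \<Rightarrow> ennreal"
  assumes "\<And>e::real. e > 0 \<Longrightarrow> \<exists>n0. \<forall>n\<ge>n0. f n \<le> ennreal e"
  shows "f \<longlonglongrightarrow> 0"
proof (rule order_tendstoI)
  fix a :: ennreal assume "0 < a"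
  then obtain c where c: "0 < c" "c < a" using dense by blast
  then obtain e where e: "c = ennreal e" "0 < e"
    by (cases c) (auto simp: ennreal_zero_less_top)
  obtain n0 where "\<forall>n\<ge>n0. f n \<le> ennreal e" using assms[OF e(2)] by blast
  then show "\<forall>\<^sub>F n in sequentially. f n < a"
    using c e by (auto simp: eventually_sequentially intro: order_le_less_trans)
qed auto

text \<open>
  The definition only provides a Cauchy sequence; Fatou's lemma, applied to \<open>\<phi>\<^sub>m - \<phi>\<^sub>n\<close> as \<open>n\<close> tends to
  infinity, shows that it converges to \<open>u\<close> in energy as well.
\<close>
lemma D_space_approx:
  fixes u :: "'a::euclidean_space \<Rightarrow> real"
  assumes s: "0 < s" "s < 1" and u: "u \<in> D_space s"
  shows "\<exists>\<phi>::nat \<Rightarrow> 'a \<Rightarrow> real. (\<forall>n. \<phi> n \<in> Cc_infinity) \<and>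
    (\<lambda>n. energy s (\<lambda>x. \<phi> n x - u x)) \<longlonglongrightarrow> 0 \<and> (AE x in lborel. (\<lambda>n. \<phi> n x) \<longlonglongrightarrow> u x)"
proof -
  let ?C = "C_const DIM('a) s"
  note [measurable] = D_space_measurable[OF u]
  obtain \<phi> where \<phi>: "\<And>n::nat. \<phi> n \<in> Cc_infinity"
    and cauchy: "\<And>e. e > 0 \<Longrightarrow> \<exists>M. \<forall>m\<ge>M. \<forall>n\<ge>M. D_norm s (\<lambda>x. \<phi> m x - \<phi> n x) < e"
    and lim: "AE x in lborel. (\<lambda>n. \<phi> n x) \<longlonglongrightarrow> u x"
    using u unfolding D_space_def by blast
  note [measurable] = Cc_infinity_measurable[OF \<phi>]
  have "(\<lambda>n. energy s (\<lambda>x. \<phi> n x - u x)) \<longlonglongrightarrow> 0"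
  proof (rule ennreal_tendsto_zeroI)
    fix e :: real assume e: "e > 0"
    define d where "d = sqrt (e * ?C / 2)"
    have d: "d > 0" "2 * d\<^sup>2 / ?C = e"
      using e C_const_pos[OF s, of "DIM('a)"] by (auto simp: d_def)
    obtain M where M: "\<And>m n. m \<ge> M \<Longrightarrow> n \<ge> M \<Longrightarrow> D_norm s (\<lambda>x. \<phi> m x - \<phi> n x) < d"
      using cauchy[OF d(1)] by blast
    have "energy s (\<lambda>x. \<phi> m x - u x) \<le> ennreal e" if "m \<ge> M" for m
    proof -
      have "energy s (\<lambda>x. \<phi> m x - u x) \<le> liminf (\<lambda>n. energy s (\<lambda>x. \<phi> m x - \<phi> n x))"
        using lim by (intro energy_Fatou) (auto intro!: tendsto_intros)
      also have "\<dots> \<le> liminf (\<lambda>n. ennreal e)"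
      proof (rule Liminf_mono, rule eventually_sequentiallyI)
        fix n assume "n \<ge> M"
        with M[OF that] have "D_norm s (\<lambda>x. \<phi> m x - \<phi> n x) < d" by blast
        then show "energy s (\<lambda>x. \<phi> m x - \<phi> n x) \<le> ennreal e"
          using d energy_Cc_infinity_finite[OF s Cc_infinity_diff[OF \<phi> \<phi>], of m n]
          by (subst (asm) D_norm_less_iff) (auto simp: s)
      qed
      also have "\<dots> = ennreal e" by (simp add: Liminf_const)
      finally show ?thesis .
    qed
    then show "\<exists>n0. \<forall>n\<ge>n0. energy s (\<lambda>x. \<phi> n x - u x) \<le> ennreal e" by blast
  qed
  with \<phi> lim show ?thesis by blast
qed

lemma energy_D_space_finite:
  fixes u :: "'a::euclidean_space \<Rightarrow> real"
  assumes s: "0 < s" "s < 1" and u: "u \<in> D_space s"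
  shows "energy s u < \<infinity>"
proof -
  note [measurable] = D_space_measurable[OF u]
  obtain \<phi> where \<phi>: "\<And>n::nat. \<phi> n \<in> Cc_infinity"
    and lim: "(\<lambda>n. energy s (\<lambda>x. \<phi> n x - u x)) \<longlonglongrightarrow> 0"
    and "AE x in lborel. (\<lambda>n. \<phi> n x) \<longlonglongrightarrow> u x"
    using D_space_approx[OF s u] by blast
  note [measurable] = Cc_infinity_measurable[OF \<phi>]
  have "\<forall>\<^sub>F n in sequentially. energy s (\<lambda>x. \<phi> n x - u x) < 1"
    using order_tendstoD(2)[OF lim] by simp
  then obtain n where n: "energy s (\<lambda>x. u x - \<phi> n x) < 1"
    unfolding energy_diff_commute[of s u] by (auto simp: eventually_sequentially)
  have "energy s u \<le> ennreal (1 + 1) * energy s (\<phi> n) + ennreal (1 + 1 / 1) * energy s (\<lambda>x. u x - \<phi> n x)"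
    by (rule energy_triangle) auto
  also have "\<dots> < \<infinity>"
    using n energy_Cc_infinity_finite[OF s \<phi>, of n]
    by (auto simp: ennreal_mult_less_top intro: order_less_trans)
  finally show ?thesis .
qed

lemma D_spaceI:
  fixes u :: "'a::euclidean_space \<Rightarrow> real"
  assumes s: "0 < s" "s < 1" and [measurable]: "u \<in> borel_measurable borel"
    and \<phi>: "\<And>n::nat. \<phi> n \<in> Cc_infinity"
    and lim: "(\<lambda>n. energy s (\<lambda>x. \<phi> n x - u x)) \<longlonglongrightarrow> 0"
    and ae: "AE x in lborel. (\<lambda>n. \<phi> n x) \<longlonglongrightarrow> u x"
  shows "u \<in> D_space s"
proof -
  let ?C = "C_const DIM('a) s"
  note [measurable] = Cc_infinity_measurable[OF \<phi>]
  have "\<exists>M. \<forall>m\<ge>M. \<forall>n\<ge>M. D_norm s (\<lambda>x. \<phi> m x - \<phi> n x) < e" if e: "e > 0" for e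
  proof -
    define d where "d = e\<^sup>2 / (4 * ?C)"
    have d: "d > 0" "4 * d < 2 * e\<^sup>2 / ?C"
      using e C_const_pos[OF s, of "DIM('a)"] by (auto simp: d_def field_simps)
    have "\<forall>\<^sub>F n in sequentially. energy s (\<lambda>x. \<phi> n x - u x) < ennreal d"
      using order_tendstoD(2)[OF lim] d by simp
    then obtain M where M: "\<And>n. n \<ge> M \<Longrightarrow> energy s (\<lambda>x. \<phi> n x - u x) < ennreal d"
      by (auto simp: eventually_sequentially)
    have "D_norm s (\<lambda>x. \<phi> m x - \<phi> n x) < e" if "m \<ge> M" "n \<ge> M" for m n
    proof -
      have "energy s (\<lambda>x. \<phi> m x - \<phi> n x) \<le> ennreal (1 + 1) * energy s (\<lambda>x. \<phi> m x - u x)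
          + ennreal (1 + 1 / 1) * energy s (\<lambda>x. (\<phi> m x - \<phi> n x) - (\<phi> m x - u x))"
        by (rule energy_triangle) auto
      also have "energy s (\<lambda>x. (\<phi> m x - \<phi> n x) - (\<phi> m x - u x)) = energy s (\<lambda>x. \<phi> n x - u x)"
        by (subst energy_diff_commute) simp
      also have "ennreal (1 + 1) * energy s (\<lambda>x. \<phi> m x - u x) + ennreal (1 + 1 / 1) * energy s (\<lambda>x. \<phi> n x - u x)
          \<le> ennreal (1 + 1) * ennreal d + ennreal (1 + 1 / 1) * ennreal d"
        using M that by (intro add_mono mult_left_mono less_imp_le) auto
      also have "\<dots> = ennreal (4 * d)"
        using d by (simp add: ennreal_mult[symmetric] ennreal_plus[symmetric] del: ennreal_plus ennreal_numeral)
      also have "\<dots> < ennreal (2 * e\<^sup>2 / ?C)"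
        using d by (intro ennreal_lessI) auto
      finally show ?thesis
        using e energy_Cc_infinity_finite[OF s Cc_infinity_diff[OF \<phi> \<phi>], of m n]
        by (subst D_norm_less_iff) (auto simp: s)
    qed
    then show ?thesis by blast
  qed
  with \<phi> ae show ?thesis unfolding D_space_def by auto
qed

lemma energy_zero: "energy s (\<lambda>x. 0) = 0"
  by (simp add: energy_def jump_def)

lemma Cc_infinity_subset_D_space:
  "0 < s \<Longrightarrow> s < 1 \<Longrightarrow> f \<in> Cc_infinity \<Longrightarrow> f \<in> D_space s"
  by (rule D_spaceI[of s f "\<lambda>n. f"]) (auto simp: energy_zero Cc_infinity_measurable)

lemma D_norm_sq_ennreal:
  fixes u :: "'a::euclidean_space \<Rightarrow> real"
  assumes s: "0 < s" "s < 1" and u: "u \<in> D_space s"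
  shows "ennreal ((D_norm s u)\<^sup>2) = ennreal (C_const DIM('a) s / 2) * energy s u"
proof -
  note [measurable] = D_space_measurable[OF u]
  obtain r where "energy s u = ennreal r" "r \<ge> 0"
    using energy_D_space_finite[OF s u] by (cases "energy s u") auto
  then show ?thesis
    using C_const_pos[OF s, of "DIM('a)"]
    by (simp add: D_norm_sq D_inner_self s ennreal_mult[symmetric])
qed

definition hardy_integral :: "real \<Rightarrow> ('a::euclidean_space \<Rightarrow> real) \<Rightarrow> ennreal" where
  "hardy_integral s u = (\<integral>\<^sup>+x. ennreal ((u x)\<^sup>2 / norm x powr (2 * s)) \<partial>lborel)"

lemma hardy_integral_Fatou:
  fixes u :: "'a::euclidean_space \<Rightarrow> real"
  assumes [measurable]: "\<And>n. f n \<in> borel_measurable borel"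
    and lim: "AE x in lborel. (\<lambda>n. f n x) \<longlonglongrightarrow> u x"
  shows "hardy_integral s u \<le> liminf (\<lambda>n. hardy_integral s (f n))"
proof -
  have "hardy_integral s u = (\<integral>\<^sup>+x. liminf (\<lambda>n. ennreal ((f n x)\<^sup>2 / norm x powr (2 * s))) \<partial>lborel)"
    unfolding hardy_integral_def
  proof (rule nn_integral_cong_AE, use lim in eventually_elim)
    case (elim x)
    then have "(\<lambda>n. ennreal ((f n x)\<^sup>2 * inverse (norm x powr (2 * s))))
        \<longlonglongrightarrow> ennreal ((u x)\<^sup>2 * inverse (norm x powr (2 * s)))"
      by (intro tendsto_intros)
    then show ?case unfolding divide_inverse by (intro lim_imp_Liminf[symmetric]) simp_all
  qed
  also have "\<dots> \<le> liminf (\<lambda>n. hardy_integral s (f n))"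
    unfolding hardy_integral_def by (intro nn_integral_liminf) measurable
  finally show ?thesis .
qed

text \<open>
  Along an approximating sequence of test functions the weighted integral is lower semicontinuous by
  Fatou's lemma, and the energies are at most \<open>1 + e\<close> times that of the limit, plus a remainder that
  vanishes.
\<close>
lemma hardy_inequality_extends:
  fixes u :: "'a::euclidean_space \<Rightarrow> real"
  assumes s: "0 < s" "s < 1" and u: "u \<in> D_space s" and "h \<ge> 0"
    and test: "\<And>\<phi>::'a \<Rightarrow> real. \<phi> \<in> Cc_infinity \<Longrightarrow> ennreal h * hardy_integral s \<phi> \<le> ennreal ((D_norm s \<phi>)\<^sup>2)"
  shows "ennreal h * hardy_integral s u \<le> ennreal ((D_norm s u)\<^sup>2)"
proof -
  let ?c = "C_const DIM('a) s / 2"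
  have c: "?c > 0" using C_const_pos[OF s] by simp
  note [measurable] = D_space_measurable[OF u]
  obtain \<phi> where \<phi>: "\<And>n::nat. \<phi> n \<in> Cc_infinity"
    and lim: "(\<lambda>n. energy s (\<lambda>x. \<phi> n x - u x)) \<longlonglongrightarrow> 0"
    and ae: "AE x in lborel. (\<lambda>n. \<phi> n x) \<longlonglongrightarrow> u x"
    using D_space_approx[OF s u] by blast
  note [measurable] = Cc_infinity_measurable[OF \<phi>]
  have eta: "ennreal h * hardy_integral s u \<le> ennreal ?c * (ennreal (1 + e) * energy s u)" if "e > 0" for e
  proof -
    have "ennreal h * hardy_integral s u \<le> ennreal h * liminf (\<lambda>n. hardy_integral s (\<phi> n))"
      by (intro mult_left_mono hardy_integral_Fatou ae) auto
    also have "\<dots> = liminf (\<lambda>n. ennreal h * hardy_integral s (\<phi> n))"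
      by (rule Liminf_compose_continuous_mono[symmetric])
        (auto intro!: ennreal_continuous_on_cmult mult_left_mono continuous_on_id simp: mono_def)
    also have "\<dots> \<le> liminf (\<lambda>n. ennreal ?c * (ennreal (1 + e) * energy s u
        + ennreal (1 + 1 / e) * energy s (\<lambda>x. \<phi> n x - u x)))"
    proof (intro Liminf_mono always_eventually allI)
      fix n
      have "ennreal h * hardy_integral s (\<phi> n) \<le> ennreal ?c * energy s (\<phi> n)"
        using test[OF \<phi>[of n]] D_norm_sq_ennreal[OF s Cc_infinity_subset_D_space[OF s \<phi>[of n]]] by simp
      also have "\<dots> \<le> ennreal ?c * (ennreal (1 + e) * energy s u
        + ennreal (1 + 1 / e) * energy s (\<lambda>x. \<phi> n x - u x))"
        using that by (intro mult_left_mono energy_triangle) auto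
      finally show "ennreal h * hardy_integral s (\<phi> n) \<le> \<dots>" .
    qed
    also have "\<dots> = ennreal ?c * (ennreal (1 + e) * energy s u + ennreal (1 + 1 / e) * 0)"
      by (intro lim_imp_Liminf ennreal_tendsto_cmult tendsto_add tendsto_const lim) simp_all
    finally show ?thesis by simp
  qed
  obtain r where r: "energy s u = ennreal r" "r \<ge> 0"
    using energy_D_space_finite[OF s u] by (cases "energy s u") auto
  have "ennreal h * hardy_integral s u \<le> ennreal (?c * r)"
  proof (rule ennreal_le_epsilon)
    fix e :: real assume "e > 0"
    define d where "d = e / (?c * r + 1)"
    have "?c * r \<ge> 0" using r c by auto
    then have d: "d > 0" "d * (?c * r) \<le> e" using \<open>e > 0\<close> by (auto simp: d_def field_simps)
    have "ennreal h * hardy_integral s u \<le> ennreal (?c * ((1 + d) * r))"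
    proof -
      have "ennreal (1 + d) * ennreal r = ennreal ((1 + d) * r)"
        using d r by (intro ennreal_mult[symmetric]) auto
      moreover have "ennreal ?c * ennreal ((1 + d) * r) = ennreal (?c * ((1 + d) * r))"
        using d r c by (intro ennreal_mult[symmetric]) auto
      ultimately show ?thesis using eta[OF d(1)] r by metis
    qed
    also have "\<dots> \<le> ennreal (?c * r + e)"
      using d by (intro ennreal_leI) (simp add: algebra_simps)
    also have "\<dots> = ennreal (?c * r) + ennreal e"
      using \<open>e > 0\<close> \<open>?c * r \<ge> 0\<close> by simp
    finally show "ennreal h * hardy_integral s u \<le> ennreal (?c * r) + ennreal e" .
  qed
  also have "ennreal (?c * r) = ennreal ((D_norm s u)\<^sup>2)"
    unfolding D_norm_sq_ennreal[OF s u] r(1) using r c by (intro ennreal_mult) auto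
  finally show ?thesis .
qed

lemma integrable_hardy_shift:
  fixes f :: "'a::euclidean_space \<Rightarrow> real"
  assumes s: "0 < s" "2 * s < real DIM('a)" and f: "f \<in> Cc_infinity"
  shows "integrable lborel (\<lambda>x. (f x)\<^sup>2 / norm (x - b) powr (2 * s))"
proof -
  obtain R where R: "R > 0" "\<And>x. norm x > R \<Longrightarrow> f x = 0"
    using f unfolding Cc_infinity_iff by blast
  obtain M where M: "M > 0" "\<And>x. \<bar>f x\<bar> \<le> M" using Cc_infinity_bounded[OF f] by blast
  note [measurable] = Cc_infinity_measurable[OF f]
  let ?k = "\<lambda>x::'a. indicator (cball (0::'a) (R + norm b)) x / norm x powr (2 * s)"
  have "(\<integral>\<^sup>+x. ennreal ((f x)\<^sup>2 / norm (x - b) powr (2 * s)) \<partial>lborel)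
      = (\<integral>\<^sup>+x. ennreal ((f (b + x))\<^sup>2 / norm x powr (2 * s)) \<partial>lborel)"
    by (subst nn_integral_lborel_affine[of _ 1 b]) auto
  also have "\<dots> \<le> (\<integral>\<^sup>+x. ennreal (M\<^sup>2) * ennreal (?k x) \<partial>lborel)"
  proof (rule nn_integral_mono)
    fix x
    have "(f (b + x))\<^sup>2 / norm x powr (2 * s) \<le> M\<^sup>2 * ?k x"
    proof (cases "norm x \<le> R + norm b")
      case True
      have "(f (b + x))\<^sup>2 \<le> M\<^sup>2"
        using M(2)[of "b + x"] M(1) by (intro abs_le_square_iff[THEN iffD1]) auto
      then show ?thesis using True by (simp add: divide_right_mono)
    next
      case False
      then have "norm (b + x) > R" using norm_diff_ineq[of x b] by (simp add: add.commute)
      then show ?thesis using R by simp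
    qed
    then show "ennreal ((f (b + x))\<^sup>2 / norm x powr (2 * s)) \<le> ennreal (M\<^sup>2) * ennreal (?k x)"
      by (simp add: ennreal_mult[symmetric] ennreal_leI)
  qed
  also have "\<dots> < \<infinity>"
    using nn_integral_powr_local_radius[where 'a = 'a and p = "2 * s" and R = "R + norm b"] s
    by (simp add: nn_integral_cmult ennreal_mult_less_top)
  finally show ?thesis
    by (intro integrableI_nonneg) auto
qed

lemma hardy_integral_test:
  fixes f :: "'a::euclidean_space \<Rightarrow> real"
  assumes s: "0 < s" "2 * s < real DIM('a)" and f: "f \<in> Cc_infinity"
  shows "hardy_integral s f = ennreal (\<integral>x. (f x)\<^sup>2 / norm x powr (2 * s) \<partial>lborel)"
  unfolding hardy_integral_def
  using integrable_hardy_shift[OF assms, of 0] by (intro nn_integral_eq_integral) auto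

text \<open>
  The best constant is a supremum, so it has to be checked that the admissible constants are bounded;
  the bump function does this.  A constant above the supremum is then violated by some element of the
  space, and hence, by extension from test functions, by some test function.
\<close>
lemma test_function_above_hardy_const:
  assumes s: "0 < s" "s < 1" "2 * s < real DIM('a::euclidean_space)"
    and l: "l > hardy_const TYPE('a::euclidean_space) s"
  obtains \<phi> :: "'a::euclidean_space \<Rightarrow> real" where "\<phi> \<in> Cc_infinity"
    "D_inner s \<phi> \<phi> < l * (\<integral>x. (\<phi> x)\<^sup>2 / norm x powr (2 * s) \<partial>lborel)"
proof -
  let ?S = "{h. 0 \<le> h \<and> (\<forall>u \<in> (D_space s :: ('a \<Rightarrow> real) set).
        ennreal h * hardy_integral s u \<le> ennreal ((D_norm s u)\<^sup>2))}"
  have S: "hardy_const TYPE('a) s = Sup ?S" unfolding hardy_const_def hardy_integral_def ..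
  have "0 \<in> ?S" by simp
  have bdd: "bdd_above ?S"
  proof (rule bdd_aboveI)
    define b :: "'a \<Rightarrow> real" where "b x = flat 0 (1 - x \<bullet> x)" for x
    have b: "b \<in> Cc_infinity" unfolding b_def by (rule Cc_infinity_bump)
    note [measurable] = Cc_infinity_measurable[OF b]
    define I where "I = (\<integral>x. (b x)\<^sup>2 / norm x powr (2 * s) \<partial>lborel)"
    have I: "hardy_integral s b = ennreal I" "I \<ge> 0"
      unfolding I_def using s by (auto intro: hardy_integral_test b)
    have "I \<noteq> 0"
    proof
      assume "I = 0"
      then have "hardy_integral s b = 0" using I by simp
      then have "AE x in lborel. ennreal ((b x)\<^sup>2 / norm x powr (2 * s)) = 0"
        unfolding hardy_integral_def by (subst (asm) nn_integral_0_iff_AE) simp_all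
      then have "AE x in lborel. x \<notin> ball (0::'a) 1"
        using AE_lborel_singleton[of "0::'a"]
      proof eventually_elim
        case (elim x)
        show ?case
        proof
          assume "x \<in> ball 0 1"
          then have "x \<bullet> x < 1" by (simp add: dot_square_norm power_less_one_iff)
          then have "b x > 0" by (simp add: b_def flat_def)
          with elim show False by (simp add: ennreal_eq_0_iff divide_le_0_iff)
        qed
      qed
      then have "emeasure lborel (ball (0::'a) 1) = 0"
        by (subst (asm) AE_iff_measurable[of "ball (0::'a) 1"]) auto
      then show False
        using unit_ball_vol_pos[of "real DIM('a)"] by (simp add: emeasure_ball)
    qed
    with I have I0: "I > 0" by simp
    fix h assume h: "h \<in> ?S"
    then have "ennreal h * ennreal I \<le> ennreal ((D_norm s b)\<^sup>2)"
      using Cc_infinity_subset_D_space[OF s(1,2) b] I by auto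
    then have "h * I \<le> (D_norm s b)\<^sup>2"
      using h I by (subst (asm) ennreal_mult[symmetric]) auto
    then show "h \<le> (D_norm s b)\<^sup>2 / I" using I0 by (simp add: field_simps)
  qed
  have "0 \<le> Sup ?S" using cSup_upper[OF \<open>0 \<in> ?S\<close> bdd] .
  then have l0: "l \<ge> 0" using l S by simp
  have "l \<notin> ?S" using cSup_upper[OF _ bdd, of l] l S by auto
  then obtain u :: "'a \<Rightarrow> real" where "u \<in> D_space s" "\<not> ennreal l * hardy_integral s u \<le> ennreal ((D_norm s u)\<^sup>2)"
    using l0 by auto
  then obtain \<phi> :: "'a \<Rightarrow> real" where \<phi>: "\<phi> \<in> Cc_infinity"
      and less: "\<not> ennreal l * hardy_integral s \<phi> \<le> ennreal ((D_norm s \<phi>)\<^sup>2)"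
    using hardy_inequality_extends[OF s(1,2) _ l0] by blast
  note [measurable] = Cc_infinity_measurable[OF \<phi>]
  have "ennreal (D_inner s \<phi> \<phi>) < ennreal (l * (\<integral>x. (\<phi> x)\<^sup>2 / norm x powr (2 * s) \<partial>lborel))"
    using less l0 by (simp add: hardy_integral_test \<phi> s D_norm_sq ennreal_mult')
  then have "D_inner s \<phi> \<phi> < l * (\<integral>x. (\<phi> x)\<^sup>2 / norm x powr (2 * s) \<partial>lborel)"
    by (metis ennreal_leI not_le)
  with \<phi> that show ?thesis by blast
qed

section \<open>Rescaled test functions\<close>

lemma energy_iterated:
  fixes u :: "'a::euclidean_space \<Rightarrow> real"
  assumes [measurable]: "u \<in> borel_measurable borel"
  shows "energy s u = (\<integral>\<^sup>+x. \<integral>\<^sup>+y. ennreal ((u x - u y)\<^sup>2 / norm (x - y) powr (real DIM('a) + 2 * s)) \<partial>lborel \<partial>lborel)"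
  unfolding energy_def pairs_def jump_def
  by (subst nn_integral_density, measurable, subst lborel.nn_integral_fst[symmetric])
    (auto simp: ennreal_mult'[symmetric])

lemma Cc_infinity_rescale:
  fixes f :: "'a::euclidean_space \<Rightarrow> real"
  assumes f: "f \<in> Cc_infinity" and r: "r > 0"
  shows "(\<lambda>x. f ((1 / r) *\<^sub>R (x - t))) \<in> Cc_infinity"
proof -
  obtain R where R: "R > 0" "\<And>x. norm x > R \<Longrightarrow> f x = 0"
    using f unfolding Cc_infinity_iff by blast
  have "f ((1 / r) *\<^sub>R (x - t)) = 0" if "norm x > r * R + norm t" for x
  proof (rule R(2))
    have "r * R < norm (x - t)" using that norm_triangle_ineq2[of x t] by simp
    then show "R < norm ((1 / r) *\<^sub>R (x - t))" using r by (simp only: norm_scaleR) (simp add: field_simps)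
  qed
  moreover have "r * R + norm t > 0" using R r by (simp add: add_pos_nonneg)
  ultimately show ?thesis
    using f unfolding Cc_infinity_iff by (auto intro: C_k_affine)
qed

lemma powr_rescale:
  assumes "r > 0" shows "r ^ n * (1 / r powr b) = r powr (real n - b)"
  using assms by (simp add: powr_diff powr_realpow)

lemma D_inner_rescale:
  fixes f :: "'a::euclidean_space \<Rightarrow> real"
  assumes [measurable]: "f \<in> borel_measurable borel" and r: "r > 0" and s: "0 < s" "s < 1"
  shows "D_inner s (\<lambda>x. f ((1 / r) *\<^sub>R (x - t))) (\<lambda>x. f ((1 / r) *\<^sub>R (x - t)))
    = r powr (real DIM('a) - 2 * s) * D_inner s f f"
proof -
  let ?N = "real DIM('a)"
  have "energy s (\<lambda>x. f ((1 / r) *\<^sub>R (x - t)))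
    = ennreal (r ^ DIM('a)) * (\<integral>\<^sup>+x. \<integral>\<^sup>+y.
        ennreal ((f ((1 / r) *\<^sub>R (t + r *\<^sub>R x - t)) - f ((1 / r) *\<^sub>R (y - t)))\<^sup>2
           / norm (t + r *\<^sub>R x - y) powr (?N + 2 * s)) \<partial>lborel \<partial>lborel)"
    using r by (subst energy_iterated, measurable, subst nn_integral_lborel_affine[of _ r t]) auto
  also have "\<dots> = ennreal (r ^ DIM('a)) * (\<integral>\<^sup>+x. ennreal (r ^ DIM('a)) * (\<integral>\<^sup>+y.
        ennreal ((f ((1 / r) *\<^sub>R (t + r *\<^sub>R x - t)) - f ((1 / r) *\<^sub>R (t + r *\<^sub>R y - t)))\<^sup>2
           / norm (t + r *\<^sub>R x - (t + r *\<^sub>R y)) powr (?N + 2 * s)) \<partial>lborel) \<partial>lborel)"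
    using r by (subst (2) nn_integral_lborel_affine[of _ r t]) auto
  also have "\<dots> = ennreal (r ^ DIM('a)) * (\<integral>\<^sup>+x. ennreal (r ^ DIM('a)) * (\<integral>\<^sup>+y.
       ennreal (1 / r powr (?N + 2 * s)) * ennreal ((f x - f y)\<^sup>2 / norm (x - y) powr (?N + 2 * s)) \<partial>lborel) \<partial>lborel)"
  proof -
    have "norm (t + r *\<^sub>R x - (t + r *\<^sub>R y)) powr p = r powr p * norm (x - y) powr p" for x y :: 'a and p
      using r by (simp add: scaleR_diff_right[symmetric] powr_mult)
    then show ?thesis using r by (simp add: ennreal_mult'[symmetric] divide_simps)
  qed
  also have "\<dots> = ennreal (r ^ DIM('a)) * ennreal (r ^ DIM('a)) * ennreal (1 / r powr (?N + 2 * s)) * energy s f"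
    by (subst energy_iterated, measurable)
      (simp add: nn_integral_cmult mult.assoc)
  also have "ennreal (r ^ DIM('a)) * ennreal (r ^ DIM('a)) * ennreal (1 / r powr (?N + 2 * s))
      = ennreal (r powr (?N - 2 * s))"
  proof -
    have "r ^ DIM('a) * r ^ DIM('a) * (1 / r powr (?N + 2 * s)) = r powr (real (DIM('a) + DIM('a)) - (?N + 2 * s))"
      using powr_rescale[OF r, of "DIM('a) + DIM('a)"] by (simp only: power_add)
    then show ?thesis using r by (simp add: ennreal_mult[symmetric] del: ennreal_mult)
  qed
  finally have "enn2real (energy s (\<lambda>x. f ((1 / r) *\<^sub>R (x - t)))) = r powr (?N - 2 * s) * enn2real (energy s f)"
    by (simp add: enn2real_mult)
  then show ?thesis using s by (simp add: D_inner_self)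
qed

definition hardy_shift :: "real \<Rightarrow> ('a::euclidean_space \<Rightarrow> real) \<Rightarrow> 'a \<Rightarrow> real" where
  "hardy_shift s f b = (\<integral>x. (f x)\<^sup>2 / norm (x - b) powr (2 * s) \<partial>lborel)"

lemma hardy_shift_rescale:
  fixes f :: "'a::euclidean_space \<Rightarrow> real"
  assumes [measurable]: "f \<in> borel_measurable borel" and r: "r > 0"
  shows "hardy_shift s (\<lambda>x. f ((1 / r) *\<^sub>R (x - t))) b
    = r powr (real DIM('a) - 2 * s) * hardy_shift s f ((1 / r) *\<^sub>R (b - t))"
proof -
  have n: "norm (t + r *\<^sub>R x - b) powr (2 * s) = r powr (2 * s) * norm (x - (1 / r) *\<^sub>R (b - t)) powr (2 * s)" for x
  proof -
    have "t + r *\<^sub>R x - b = r *\<^sub>R (x - (1 / r) *\<^sub>R (b - t))" using r by (simp add: algebra_simps)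
    then show ?thesis using r by (simp add: powr_mult)
  qed
  have "hardy_shift s (\<lambda>x. f ((1 / r) *\<^sub>R (x - t))) b
      = r ^ DIM('a) * (\<integral>x. (1 / r powr (2 * s)) * ((f x)\<^sup>2 / norm (x - (1 / r) *\<^sub>R (b - t)) powr (2 * s)) \<partial>lborel)"
    unfolding hardy_shift_def
    by (subst lborel_integral_affine[of _ r t], measurable) (use r in \<open>simp_all add: n\<close>)
  also have "\<dots> = (r ^ DIM('a) * (1 / r powr (2 * s))) * hardy_shift s f ((1 / r) *\<^sub>R (b - t))"
    unfolding hardy_shift_def by (subst integral_mult_right_zero) simp
  finally show ?thesis unfolding powr_rescale[OF r] .
qed

text \<open>
  The poles may have coefficients of either sign, so the potential is integrated pole by pole.
\<close>
lemma H_pot_test: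
  fixes f :: "'a::euclidean_space \<Rightarrow> real"
  assumes s: "0 < s" "2 * s < real DIM('a)" and f: "f \<in> Cc_infinity"
  shows "integrable lborel (\<lambda>x. H_pot s k lam a x * f x * f x)"
    and "(\<integral>x. H_pot s k lam a x * f x * f x \<partial>lborel) = (\<Sum>i=1..k. lam i * hardy_shift s f (a i))"
proof -
  have e: "H_pot s k lam a x * f x * f x = (\<Sum>i=1..k. lam i * ((f x)\<^sup>2 / norm (x - a i) powr (2 * s)))" for x
    unfolding H_pot_def sum_distrib_right by (simp add: power2_eq_square mult.assoc)
  note i = integrable_hardy_shift[OF s f]
  show "integrable lborel (\<lambda>x. H_pot s k lam a x * f x * f x)"
    unfolding e by (intro Bochner_Integration.integrable_sum integrable_mult_right i)
  show "(\<integral>x. H_pot s k lam a x * f x * f x \<partial>lborel) = (\<Sum>i=1..k. lam i * hardy_shift s f (a i))"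
    unfolding e hardy_shift_def
    by (subst Bochner_Integration.integral_sum) (auto intro!: integrable_mult_right i simp del: times_divide_eq_right)
qed

text \<open>
  Energy and weighted integrals have the same homogeneity, so rescaling a test function amounts to
  rescaling the configuration of poles.
\<close>
lemma Q_form_rescale:
  fixes f :: "'a::euclidean_space \<Rightarrow> real"
  assumes s: "0 < s" "s < 1" "2 * s < real DIM('a)" and f: "f \<in> Cc_infinity" and r: "r > 0"
  shows "Q_form s k lam a (\<lambda>x. f ((1 / r) *\<^sub>R (x - t))) (\<lambda>x. f ((1 / r) *\<^sub>R (x - t)))
    = r powr (real DIM('a) - 2 * s)
      * (D_inner s f f - (\<Sum>i=1..k. lam i * hardy_shift s f ((1 / r) *\<^sub>R (a i - t))))"
  unfolding Q_form_def
  using Cc_infinity_measurable[OF f] r s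
  by (simp add: H_pot_test Cc_infinity_rescale f D_inner_rescale hardy_shift_rescale
      right_diff_distrib sum_distrib_left mult.left_commute)

lemma hardy_shift_nonneg: "hardy_shift s f b \<ge> 0"
  unfolding hardy_shift_def by (intro Bochner_Integration.integral_nonneg) auto

lemma hardy_shift_tendsto_0:
  fixes f :: "'a::euclidean_space \<Rightarrow> real"
  assumes s: "0 < s" "2 * s < real DIM('a)" and f: "f \<in> Cc_infinity"
    and b: "filterlim (\<lambda>n. norm (b n)) at_top F"
  shows "((\<lambda>n. hardy_shift s f (b n)) \<longlongrightarrow> 0) F"
proof -
  obtain R where R: "R > 0" "\<And>x. norm x > R \<Longrightarrow> f x = 0"
    using f unfolding Cc_infinity_iff by blast
  obtain M where M: "M > 0" "\<And>x. \<bar>f x\<bar> \<le> M" using Cc_infinity_bounded[OF f] by blast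
  note [measurable] = Cc_infinity_measurable[OF f]
  let ?I = "\<integral>x. M\<^sup>2 * indicator (cball (0::'a) R) x \<partial>lborel"
  let ?g = "\<lambda>n. ?I * (norm (b n) - R) powr (- (2 * s))"
  have "\<forall>\<^sub>F n in F. norm (b n) > R" using b by (simp add: filterlim_at_top_dense)
  then have "\<forall>\<^sub>F n in F. hardy_shift s f (b n) \<le> ?g n"
  proof eventually_elim
    case (elim n)
    have "hardy_shift s f (b n)
        \<le> (\<integral>x. (M\<^sup>2 * indicator (cball (0::'a) R) x) * (norm (b n) - R) powr (- (2 * s)) \<partial>lborel)"
      unfolding hardy_shift_def
    proof (rule integral_mono)
      show "integrable lborel (\<lambda>x. (f x)\<^sup>2 / norm (x - b n) powr (2 * s))"
        by (rule integrable_hardy_shift[OF s f])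
      show "integrable lborel (\<lambda>x. M\<^sup>2 * indicator (cball (0::'a) R) x * (norm (b n) - R) powr (- (2 * s)))"
        using emeasure_lborel_cball_finite[of "0::'a" R] by simp
      fix x :: 'a
      show "(f x)\<^sup>2 / norm (x - b n) powr (2 * s)
          \<le> M\<^sup>2 * indicator (cball 0 R) x * (norm (b n) - R) powr (- (2 * s))"
      proof (cases "norm x \<le> R")
        case True
        have "norm (b n) - R \<le> norm (x - b n)"
          using True norm_triangle_ineq2[of "b n" x] by (simp add: norm_minus_commute)
        then have 1: "(norm (b n) - R) powr (2 * s) \<le> norm (x - b n) powr (2 * s)"
          using elim s by (intro powr_mono2) auto
        have 2: "(norm (b n) - R) powr (2 * s) > 0" using elim by simp
        have "(f x)\<^sup>2 \<le> M\<^sup>2"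
          using M(2)[of x] M(1) by (intro abs_le_square_iff[THEN iffD1]) auto
        then have "(f x)\<^sup>2 / norm (x - b n) powr (2 * s) \<le> M\<^sup>2 / (norm (b n) - R) powr (2 * s)"
          using 1 2 by (intro frac_le) auto
        then show ?thesis using True by (simp add: powr_minus divide_inverse)
      qed (simp add: R)
    qed
    also have "\<dots> = ?g n" by (rule integral_mult_left_zero)
    finally show ?case .
  qed
  moreover have "(?g \<longlongrightarrow> ?I * 0) F"
  proof (intro tendsto_intros tendsto_neg_powr)
    show "filterlim (\<lambda>n. norm (b n) - R) at_top F"
      using filterlim_tendsto_add_at_top[OF tendsto_const[of "- R"] b] by simp
  qed (use s in simp)
  ultimately show ?thesis
    by (intro tendsto_sandwich[OF always_eventually[OF allI[OF hardy_shift_nonneg]] _ tendsto_const]) auto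
qed

text \<open>
  Translating the integration variable moves the parameter from the singular weight into the continuous
  function \<open>f\<close>, after which dominated convergence applies.
\<close>
lemma hardy_shift_tendsto_origin:
  fixes f :: "'a::euclidean_space \<Rightarrow> real" and b :: "nat \<Rightarrow> 'a"
  assumes s: "0 < s" "2 * s < real DIM('a)" and f: "f \<in> Cc_infinity" and b: "b \<longlonglongrightarrow> 0"
  shows "(\<lambda>n. hardy_shift s f (b n)) \<longlonglongrightarrow> hardy_shift s f 0"
proof -
  obtain R where R: "R > 0" "\<And>x. norm x > R \<Longrightarrow> f x = 0"
    using f unfolding Cc_infinity_iff by blast
  obtain M where M: "M > 0" "\<And>x. \<bar>f x\<bar> \<le> M" using Cc_infinity_bounded[OF f] by blast
  obtain B where B: "B > 0" "\<And>n. norm (b n) \<le> B"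
    using convergent_imp_Bseq[of b] b by (auto simp: convergent_def Bseq_def)
  note [measurable] = Cc_infinity_measurable[OF f]
  have shift: "hardy_shift s f c = (\<integral>x. (f (c + x))\<^sup>2 / norm x powr (2 * s) \<partial>lborel)" for c
    unfolding hardy_shift_def by (subst lborel_integral_affine[of _ 1 c]) auto
  show ?thesis unfolding shift
  proof (rule integral_dominated_convergence)
    show "integrable lborel (\<lambda>x. M\<^sup>2 * (indicator (cball (0::'a) (R + B)) x / norm x powr (2 * s)))"
      using nn_integral_powr_local_radius[where 'a = 'a and p = "2 * s" and R = "R + B"] s
      by (intro integrable_mult_right integrableI_nonneg) auto
    show "AE x in lborel. (\<lambda>n. (f (b n + x))\<^sup>2 / norm x powr (2 * s)) \<longlonglongrightarrow> (f (0 + x))\<^sup>2 / norm x powr (2 * s)"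
    proof (rule AE_I2)
      fix x
      have "isCont f (0 + x)"
        using Cc_infinity_continuous[OF f] by (simp add: continuous_on_eq_continuous_at)
      then have "(\<lambda>n. f (b n + x)) \<longlonglongrightarrow> f (0 + x)"
        by (rule isCont_tendsto_compose) (intro tendsto_intros b)
      then show "(\<lambda>n. (f (b n + x))\<^sup>2 / norm x powr (2 * s)) \<longlonglongrightarrow> (f (0 + x))\<^sup>2 / norm x powr (2 * s)"
        unfolding divide_inverse by (intro tendsto_intros)
    qed
    fix n
    show "AE x in lborel. norm ((f (b n + x))\<^sup>2 / norm x powr (2 * s))
        \<le> M\<^sup>2 * (indicator (cball (0::'a) (R + B)) x / norm x powr (2 * s))"
    proof (rule AE_I2)
      fix x
      show "norm ((f (b n + x))\<^sup>2 / norm x powr (2 * s))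
        \<le> M\<^sup>2 * (indicator (cball (0::'a) (R + B)) x / norm x powr (2 * s))"
      proof (cases "norm x \<le> R + B")
        case True
        have "(f (b n + x))\<^sup>2 \<le> M\<^sup>2"
          using M(2)[of "b n + x"] M(1) by (intro abs_le_square_iff[THEN iffD1]) auto
        then show ?thesis using True by (simp add: divide_right_mono)
      next
        case False
        then have "norm (b n + x) > R" using norm_diff_ineq[of x "b n"] B(2)[of n] by (simp add: add.commute)
        then show ?thesis using R by simp
      qed
    qed
  qed auto
qed

lemma Q_form_negative_from_limit:
  fixes f :: "'a::euclidean_space \<Rightarrow> real"
  assumes s: "0 < s" "s < 1" "2 * s < real DIM('a)" and f: "f \<in> Cc_infinity"
    and less: "D_inner s f f < l * hardy_shift s f 0"
    and r: "\<And>n::nat. r n > 0"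
    and lim: "(\<lambda>n. \<Sum>i=1..k. lam i * hardy_shift s f ((1 / r n) *\<^sub>R (a i - t))) \<longlonglongrightarrow> l * hardy_shift s f 0"
  shows "\<exists>u \<in> Cc_infinity. Q_form s k lam a u u < 0"
proof -
  have "\<forall>\<^sub>F n in sequentially. D_inner s f f < (\<Sum>i=1..k. lam i * hardy_shift s f ((1 / r n) *\<^sub>R (a i - t)))"
    using order_tendstoD(1)[OF lim less] .
  then obtain n where n: "D_inner s f f < (\<Sum>i=1..k. lam i * hardy_shift s f ((1 / r n) *\<^sub>R (a i - t)))"
    by (auto simp: eventually_sequentially)
  let ?u = "\<lambda>x. f ((1 / r n) *\<^sub>R (x - t))"
  have "Q_form s k lam a ?u ?u < 0"
    unfolding Q_form_rescale[OF s f r] using n r[of n] by (intro mult_pos_neg) auto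
  with Cc_infinity_rescale[OF f r] show ?thesis by blast
qed

text \<open>
  Concentrating at \<open>a\<^sub>i\<close> sends the other poles to infinity, where a compactly supported function no
  longer feels them.
\<close>
lemma Q_form_negative_pole:
  fixes a :: "nat \<Rightarrow> 'a::euclidean_space"
  assumes s: "0 < s" "s < 1" "2 * s < real DIM('a)" and inj: "inj_on a {1..k}"
    and i: "i \<in> {1..k}" "lam i > hardy_const TYPE('a) s"
  shows "\<exists>u \<in> Cc_infinity. Q_form s k lam a u u < 0"
proof -
  obtain f :: "'a \<Rightarrow> real" where f: "f \<in> Cc_infinity"
    and less: "D_inner s f f < lam i * hardy_shift s f 0"
    using test_function_above_hardy_const[OF s i(2)] by (auto simp: hardy_shift_def)
  have "(\<lambda>n. \<Sum>j=1..k. lam j * hardy_shift s f ((1 / (1 / real (Suc n))) *\<^sub>R (a j - a i)))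
    \<longlonglongrightarrow> (\<Sum>j=1..k. lam j * (if j = i then hardy_shift s f 0 else 0))"
  proof (intro tendsto_sum tendsto_mult tendsto_const)
    fix j assume j: "j \<in> {1..k}"
    show "(\<lambda>n. hardy_shift s f ((1 / (1 / real (Suc n))) *\<^sub>R (a j - a i)))
        \<longlonglongrightarrow> (if j = i then hardy_shift s f 0 else 0)"
    proof (cases "j = i")
      case False
      then have "norm (a j - a i) > 0" using inj j i by (auto dest: inj_onD)
      then have "filterlim (\<lambda>n. norm (a j - a i) * real (Suc n)) at_top sequentially"
        by (intro filterlim_tendsto_pos_mult_at_top[OF tendsto_const]
            filterlim_compose[OF filterlim_real_sequentially filterlim_Suc])
      then have "filterlim (\<lambda>n. norm ((1 / (1 / real (Suc n))) *\<^sub>R (a j - a i))) at_top sequentially"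
        by (simp add: mult.commute)
      with False show ?thesis by (simp only: if_False) (rule hardy_shift_tendsto_0[OF s(1,3) f])
    qed simp
  qed
  also have "(\<Sum>j=1..k. lam j * (if j = i then hardy_shift s f 0 else 0)) = lam i * hardy_shift s f 0"
    using i by (simp add: if_distrib[of "(*) _"] cong: if_cong)
  finally show ?thesis
    by (rule Q_form_negative_from_limit[OF s f less, rotated]) simp
qed

text \<open>
  Seen from far away, all poles coalesce into one whose coefficient is the sum of the coefficients.
\<close>
lemma Q_form_negative_sum:
  fixes a :: "nat \<Rightarrow> 'a::euclidean_space"
  assumes s: "0 < s" "s < 1" "2 * s < real DIM('a)"
    and l: "(\<Sum>i=1..k. lam i) > hardy_const TYPE('a) s"
  shows "\<exists>u \<in> Cc_infinity. Q_form s k lam a u u < 0"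
proof -
  obtain f :: "'a \<Rightarrow> real" where f: "f \<in> Cc_infinity"
    and less: "D_inner s f f < (\<Sum>i=1..k. lam i) * hardy_shift s f 0"
    using test_function_above_hardy_const[OF s l] by (auto simp: hardy_shift_def)
  have "(\<lambda>n. \<Sum>j=1..k. lam j * hardy_shift s f ((1 / real (Suc n)) *\<^sub>R (a j - 0)))
    \<longlonglongrightarrow> (\<Sum>j=1..k. lam j * hardy_shift s f 0)"
  proof (intro tendsto_sum tendsto_mult tendsto_const hardy_shift_tendsto_origin[OF s(1,3) f])
    fix j
    have "(\<lambda>n. (1 / real (Suc n)) *\<^sub>R (a j - 0)) \<longlonglongrightarrow> 0 *\<^sub>R (a j - 0)"
      using LIMSEQ_inverse_real_of_nat by (intro tendsto_intros) (simp add: inverse_eq_divide)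
    then show "(\<lambda>n. (1 / real (Suc n)) *\<^sub>R (a j - 0)) \<longlonglongrightarrow> 0" by simp
  qed
  also have "(\<Sum>j=1..k. lam j * hardy_shift s f 0) = (\<Sum>i=1..k. lam i) * hardy_shift s f 0"
    by (simp add: sum_distrib_right)
  finally show ?thesis
    by (rule Q_form_negative_from_limit[OF s f less, rotated]) simp
qed

section \<open>Admissible quotients\<close>

lemma energy_zero_imp_AE_eq:
  fixes u :: "'a::euclidean_space \<Rightarrow> real"
  assumes [measurable]: "u \<in> borel_measurable borel" and "energy s u = 0"
  shows "AE x in lborel. AE y in lborel. u x = u y"
proof -
  have "AE z in pairs s. ennreal ((jump u z)\<^sup>2) = 0"
    using assms(2) unfolding energy_def by (subst (asm) nn_integral_0_iff_AE) auto
  then have "AE z in pairs s. u (fst z) = u (snd z)"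
    by eventually_elim (simp add: jump_def)
  then have "AE z in lborel \<Otimes>\<^sub>M lborel. fst z \<noteq> snd z \<longrightarrow> u (fst z) = u (snd z)"
    unfolding pairs_def by (subst (asm) AE_density) (auto elim!: eventually_mono)
  then have "AE z in lborel \<Otimes>\<^sub>M lborel. u (fst z) = u (snd z)"
    by eventually_elim auto
  from lborel_pair.AE_pair[OF this] show ?thesis by simp
qed

text \<open>
  This makes \<open>f\<close> an admissible competitor with negative Rayleigh quotient.  A function of zero energy is
  a.e. constant, a compactly supported constant is zero, and the form vanishes at zero.
\<close>
lemma D_norm_pos_of_Q_form_negative:
  fixes f :: "'a::euclidean_space \<Rightarrow> real"
  assumes s: "0 < s" "s < 1" and f: "f \<in> Cc_infinity" and Q: "Q_form s k lam a f f < 0"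
  shows "(D_norm s f)\<^sup>2 > 0" "\<not> (AE x in lborel. f x = 0)"
proof -
  note [measurable] = Cc_infinity_measurable[OF f]
  show nz: "\<not> (AE x in lborel. f x = 0)"
  proof
    assume ae: "AE x in lborel. f x = 0"
    have "AE z in pairs s. ennreal ((jump f z)\<^sup>2) = 0"
      using AE_pairs[OF ae] by eventually_elim (simp add: jump_def)
    then have "energy s f = 0" unfolding energy_def by (subst nn_integral_0_iff_AE) auto
    then have "D_inner s f f = 0" using s by (simp add: D_inner_self)
    moreover have "(\<integral>x. H_pot s k lam a x * f x * f x \<partial>lborel) = 0"
      by (rule integral_eq_zero_AE) (use ae in eventually_elim, simp)
    ultimately show False using Q by (simp add: Q_form_def)
  qed
  show "(D_norm s f)\<^sup>2 > 0"
  proof (rule ccontr)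
    assume "\<not> ?thesis"
    then have "ennreal (C_const DIM('a) s / 2) * energy s f = 0"
      using D_norm_sq_ennreal[OF s Cc_infinity_subset_D_space[OF s f]] by simp
    then have "energy s f = 0" using C_const_pos[OF s, of "DIM('a)"] by (simp add: ennreal_eq_0_iff)
    then have "AE x in lborel. AE y in lborel. f x = f y" by (rule energy_zero_imp_AE_eq[rotated]) simp
    then have "AE x in lborel. f x = 0"
    proof eventually_elim
      case (elim x)
      obtain R where R: "\<And>x. norm x > R \<Longrightarrow> f x = 0"
        using f unfolding Cc_infinity_iff by blast
      show ?case
      proof (rule ccontr)
        assume "f x \<noteq> 0"
        have sub: "y \<in> cball 0 R" if "f x = f y" for y
          using R[of y] that \<open>f x \<noteq> 0\<close> by (auto simp: not_less[symmetric])
        from elim have "AE y in lborel. y \<in> cball (0::'a) R"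
          by (rule eventually_mono) (rule sub)
        then have "emeasure lborel (UNIV::'a set) \<le> emeasure lborel (cball (0::'a) R)"
          by (intro emeasure_mono_AE) auto
        then show False
          using emeasure_lborel_cball_finite[of "0::'a" R] by (simp add: emeasure_lborel_UNIV top_unique)
      qed
    qed
    with nz show False by blast
  qed
qed

text \<open>
  For \<open>d = 0\<close> this is \<open>1 / (e + |t|)\<close>.  For \<open>d \<noteq> 0\<close> it is a smooth function of \<open>t\<close> that obeys the same bounds,
  uniformly in \<open>d\<close>.
\<close>
definition soft_inverse :: "real \<Rightarrow> real \<Rightarrow> real \<Rightarrow> real" where
  "soft_inverse e d t = inverse (e + sqrt (t\<^sup>2 + d\<^sup>2))"

lemma soft_inverse_bounds:
  assumes "e > 0"
  shows "0 < soft_inverse e d t" "soft_inverse e d t \<le> 1 / e"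
    "\<bar>soft_inverse e d t - soft_inverse e d r\<bar> \<le> \<bar>t - r\<bar> / e\<^sup>2"
proof -
  let ?q = "\<lambda>t. sqrt (t\<^sup>2 + d\<^sup>2)"
  have pos: "e \<le> e + ?q t" for t by simp
  show "0 < soft_inverse e d t" unfolding soft_inverse_def using assms pos[of t] by (simp add: add_pos_nonneg)
  show "soft_inverse e d t \<le> 1 / e"
    unfolding soft_inverse_def inverse_eq_divide using assms pos[of t] by (intro divide_left_mono) (auto intro!: mult_pos_pos add_pos_nonneg)
  have lip: "?q x - ?q y \<le> \<bar>x - y\<bar>" for x y
    using real_sqrt_sum_squares_triangle_ineq[of y "x - y" d 0] by simp
  have p: "e + ?q t > 0" "e + ?q r > 0" using assms by (simp_all add: add_pos_nonneg)
  have "soft_inverse e d t - soft_inverse e d r = (?q r - ?q t) / ((e + ?q t) * (e + ?q r))"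
    unfolding soft_inverse_def using p by (simp add: field_simps)
  then have "\<bar>soft_inverse e d t - soft_inverse e d r\<bar> = \<bar>?q r - ?q t\<bar> / ((e + ?q t) * (e + ?q r))"
    using p by (simp add: abs_mult)
  also have "\<dots> \<le> \<bar>t - r\<bar> / (e * e)"
    using assms lip[of t r] lip[of r t] pos[of t] pos[of r]
    by (intro frac_le mult_mono) (auto simp: abs_minus_commute abs_le_iff)
  finally show "\<bar>soft_inverse e d t - soft_inverse e d r\<bar> \<le> \<bar>t - r\<bar> / e\<^sup>2"
    by (simp add: power2_eq_square)
qed

lemma soft_inverse_measurable [measurable]: "soft_inverse e d \<in> borel_measurable borel"
  unfolding soft_inverse_def by measurable

text \<open>
  The increment of a product \<open>P g(u)\<close> splits into \<open>(P(x) - P(y)) g(u(x)) + P(y) (g(u(x)) - g(u(y)))\<close>; the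
  resulting bound does not depend on \<open>d\<close>.
\<close>
lemma jump_quotient_bound:
  assumes e: "e > 0" and P: "\<And>x. \<bar>P x\<bar> \<le> M"
  shows "(jump (\<lambda>x. P x * soft_inverse e d (u x)) z)\<^sup>2
    \<le> 2 * (1 / e)\<^sup>2 * (jump P z)\<^sup>2 + 2 * (M / e\<^sup>2)\<^sup>2 * (jump u z)\<^sup>2"
proof -
  obtain x y where z: "z = (x, y)" by (cases z)
  let ?g = "soft_inverse e d"
  have M: "M \<ge> 0" using P[of x] by linarith
  have e1: "jump (\<lambda>x. P x * ?g (u x)) z = (P x - P y) * ?g (u x) + P y * (?g (u x) - ?g (u y))"
    by (simp add: jump_def z algebra_simps)
  have "\<bar>(P x - P y) * ?g (u x)\<bar> \<le> \<bar>1 / e * (P x - P y)\<bar>"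
    using soft_inverse_bounds(1,2)[OF e, of d "u x"] e
      mult_right_mono[OF soft_inverse_bounds(2)[OF e, of d "u x"], of "\<bar>P x - P y\<bar>"]
    by (simp add: abs_mult mult.commute)
  then have 1: "((P x - P y) * ?g (u x))\<^sup>2 \<le> (1 / e * (P x - P y))\<^sup>2"
    by (simp only: abs_le_square_iff)
  have "\<bar>P y * (?g (u x) - ?g (u y))\<bar> \<le> M * (\<bar>u x - u y\<bar> / e\<^sup>2)"
    unfolding abs_mult using P[of y] M soft_inverse_bounds(3)[OF e, of d "u x" "u y"]
    by (intro mult_mono) auto
  also have "\<dots> = \<bar>M / e\<^sup>2 * (u x - u y)\<bar>" using M by (simp add: abs_mult)
  finally have 2: "(P y * (?g (u x) - ?g (u y)))\<^sup>2 \<le> (M / e\<^sup>2 * (u x - u y))\<^sup>2"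
    by (simp only: abs_le_square_iff)
  have "(p + q)\<^sup>2 \<le> 2 * p\<^sup>2 + 2 * q\<^sup>2" for p q :: real
    using sum_squares_bound[of p q] by (simp add: power2_sum)
  from this[of "(P x - P y) * ?g (u x)" "P y * (?g (u x) - ?g (u y))"] 1 2
    power_mult_distrib[of "1 / e" "P x - P y" 2] power_mult_distrib[of "M / e\<^sup>2" "u x - u y" 2]
  show ?thesis unfolding e1 unfolding jump_def z fst_conv snd_conv mult.assoc by linarith
qed

lemma Cc_infinity_mult:
  assumes f: "f \<in> Cc_infinity" and g: "\<And>n. C_k n g"
  shows "(\<lambda>x. f x * g x) \<in> Cc_infinity"
proof -
  obtain R where "R > 0" "\<And>x. norm x > R \<Longrightarrow> f x = 0"
    using f unfolding Cc_infinity_iff by blast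
  with f g show ?thesis
    unfolding Cc_infinity_iff by (auto intro!: C_k_mult)
qed

lemma C_k_soft_inverse:
  assumes "e > 0" "d \<noteq> 0" "C_k n f" shows "C_k n (\<lambda>x. soft_inverse e d (f x))"
proof -
  have p: "(f x)\<^sup>2 + d\<^sup>2 > 0" for x using assms by (simp add: add_nonneg_pos)
  moreover have "e + sqrt ((f x)\<^sup>2 + d\<^sup>2) > 0" for x using assms by (simp add: add_pos_nonneg)
  ultimately show ?thesis
    unfolding soft_inverse_def power2_eq_square
    by (intro C_k_inverse C_k_add C_k_sqrt C_k_mult C_k_const assms)
      (auto simp: less_imp_neq[symmetric])
qed

text \<open>
  The increments of the approximants are dominated by those of \<open>\<phi>\<^sup>2\<close> and of \<open>f n\<close>.  The latter depend on \<open>n\<close>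
  but converge in \<open>L\<^sup>2\<close>, so their squares are dominated by the sum of a fixed integrable function and a vanishing remainder.
\<close>
lemma quotient_in_D_space:
  fixes u \<phi> :: "'a::euclidean_space \<Rightarrow> real"
  assumes s: "0 < s" "s < 1" and u: "u \<in> D_space s" and \<phi>: "\<phi> \<in> Cc_infinity" and e: "e > 0"
  shows "(\<lambda>x. (\<phi> x)\<^sup>2 / (e + \<bar>u x\<bar>)) \<in> D_space s"
proof -
  define P where "P x = (\<phi> x)\<^sup>2" for x
  have Pc: "P \<in> Cc_infinity"
    using Cc_infinity_mult[OF \<phi>, of \<phi>] \<phi> by (simp add: P_def[abs_def] power2_eq_square Cc_infinity_iff)
  obtain M where M: "\<And>x. \<bar>P x\<bar> \<le> M" using Cc_infinity_bounded[OF Pc] by blast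
  note [measurable] = D_space_measurable[OF u] Cc_infinity_measurable[OF Pc]
  obtain f where f: "\<And>n::nat. f n \<in> Cc_infinity"
    and lim: "(\<lambda>n. energy s (\<lambda>x. f n x - u x)) \<longlonglongrightarrow> 0"
    and ae: "AE x in lborel. (\<lambda>n. f n x) \<longlonglongrightarrow> u x"
    using D_space_approx[OF s u] by blast
  note [measurable] = Cc_infinity_measurable[OF f]
  define d where "d n = inverse (real (Suc n))" for n
  define v where "v x = P x * soft_inverse e 0 (u x)" for x
  define w where "w n x = P x * soft_inverse e (d n) (f n x)" for n x
  have [measurable]: "v \<in> borel_measurable borel" unfolding v_def by measurable
  have wc: "w n \<in> Cc_infinity" for n
    unfolding w_def using f[of n] e
    by (intro Cc_infinity_mult Pc C_k_soft_inverse) (auto simp: d_def Cc_infinity_iff)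
  note [measurable] = Cc_infinity_measurable[OF wc]
  have aew: "AE x in lborel. (\<lambda>n. w n x) \<longlonglongrightarrow> v x"
    using ae
  proof eventually_elim
    case (elim x)
    have "e + sqrt ((u x)\<^sup>2 + 0\<^sup>2) \<noteq> 0" using e by (simp add: add_pos_nonneg less_imp_neq[symmetric])
    moreover have "d \<longlonglongrightarrow> 0" unfolding d_def by (rule LIMSEQ_inverse_real_of_nat)
    ultimately show ?case
      unfolding v_def w_def soft_inverse_def using elim by (intro tendsto_intros)
  qed
  define A B where "A = 2 * (1 / e)\<^sup>2" and "B = 2 * (M / e\<^sup>2)\<^sup>2"
  then have AB: "A \<ge> 0" "B \<ge> 0" by simp_all
  define X where "X n z = (jump (w n) z - jump v z)\<^sup>2" for n z
  define F where "F z = 4 * A * (jump P z)\<^sup>2 + 6 * B * (jump u z)\<^sup>2" for z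
  have [measurable]: "X n \<in> borel_measurable (pairs s)" "F \<in> borel_measurable (pairs s)" for n
    unfolding X_def F_def by measurable
  have F0: "F z \<ge> 0" for z using AB by (simp add: F_def)
  have X0: "X n z \<ge> 0" for n z by (simp add: X_def)
  \<comment> \<open>truncating by \<open>F\<close> leaves an excess of at most the remainder, and dominated convergence handles the truncated part\<close>
  have XF: "X n z \<le> min (F z) (X n z) + 4 * B * (jump (\<lambda>x. f n x - u x) z)\<^sup>2" for n z
  proof -
    have sq: "(p - q)\<^sup>2 \<le> 2 * p\<^sup>2 + 2 * q\<^sup>2" "p\<^sup>2 \<le> 2 * (p - q)\<^sup>2 + 2 * q\<^sup>2" for p q :: real
      using sum_squares_bound[of p "-q"] sum_squares_bound[of "p - q" "q"]
      by (simp_all add: power2_eq_square algebra_simps)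
    have "X n z \<le> 2 * (jump (w n) z)\<^sup>2 + 2 * (jump v z)\<^sup>2"
      unfolding X_def by (rule sq)
    moreover have "(jump (w n) z)\<^sup>2 \<le> A * (jump P z)\<^sup>2 + B * (jump (f n) z)\<^sup>2"
      unfolding w_def A_def B_def by (rule jump_quotient_bound[OF e M])
    moreover have "(jump v z)\<^sup>2 \<le> A * (jump P z)\<^sup>2 + B * (jump u z)\<^sup>2"
      unfolding v_def A_def B_def by (rule jump_quotient_bound[OF e M])
    moreover have "B * (jump (f n) z)\<^sup>2 \<le> B * (2 * (jump (\<lambda>x. f n x - u x) z)\<^sup>2 + 2 * (jump u z)\<^sup>2)"
      unfolding jump_diff by (intro mult_left_mono sq AB)
    ultimately have "X n z \<le> F z + 4 * B * (jump (\<lambda>x. f n x - u x) z)\<^sup>2"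
      by (simp add: F_def algebra_simps)
    moreover have "0 \<le> 4 * B * (jump (\<lambda>x. f n x - u x) z)\<^sup>2" using AB by simp
    ultimately show ?thesis by linarith
  qed
  have min0: "(\<lambda>n. \<integral>\<^sup>+z. ennreal (min (F z) (X n z)) \<partial>pairs s) \<longlonglongrightarrow> (\<integral>\<^sup>+z. 0 \<partial>(pairs s :: ('a \<times> 'a) measure))"
  proof (rule nn_integral_dominated_convergence)
    have "(\<integral>\<^sup>+z. ennreal (F z) \<partial>pairs s) = ennreal (4 * A) * energy s P + ennreal (6 * B) * energy s u"
      unfolding F_def energy_def using AB by (simp add: ennreal_mult nn_integral_add nn_integral_cmult)
    also have "\<dots> < \<infinity>"
      using energy_Cc_infinity_finite[OF s Pc] energy_D_space_finite[OF s u] by (simp add: ennreal_mult_less_top)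
    finally show "(\<integral>\<^sup>+z. ennreal (F z) \<partial>pairs s) < \<infinity>" .
    show "AE z in pairs s. (\<lambda>n. ennreal (min (F z) (X n z))) \<longlonglongrightarrow> 0"
      using AE_pairs[OF aew]
    proof eventually_elim
      case (elim z)
      have "(\<lambda>n. X n z) \<longlonglongrightarrow> (jump v z - jump v z)\<^sup>2"
        unfolding X_def jump_def using elim by (intro tendsto_intros) auto
      then have "(\<lambda>n. min (F z) (X n z)) \<longlonglongrightarrow> min (F z) 0" by (intro tendsto_intros) simp
      then have "(\<lambda>n. ennreal (min (F z) (X n z))) \<longlonglongrightarrow> ennreal (min (F z) 0)" by (rule tendsto_ennrealI)
      then show ?case using F0[of z] by (simp add: min_absorb2)
    qed
  qed (auto intro!: ennreal_leI)
  have "(\<lambda>n. energy s (\<lambda>x. w n x - v x)) \<longlonglongrightarrow> 0"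
  proof (rule tendsto_sandwich[OF _ _ tendsto_const])
    show "\<forall>\<^sub>F n in sequentially. energy s (\<lambda>x. w n x - v x)
        \<le> (\<integral>\<^sup>+z. ennreal (min (F z) (X n z)) \<partial>pairs s) + ennreal (4 * B) * energy s (\<lambda>x. f n x - u x)"
    proof (rule always_eventually, rule allI)
      fix n
      have "energy s (\<lambda>x. w n x - v x) = (\<integral>\<^sup>+z. ennreal (X n z) \<partial>pairs s)"
        by (simp add: energy_def X_def jump_diff)
      also have "\<dots> \<le> (\<integral>\<^sup>+z. ennreal (min (F z) (X n z) + 4 * B * (jump (\<lambda>x. f n x - u x) z)\<^sup>2) \<partial>pairs s)"
        by (intro nn_integral_mono ennreal_leI XF)
      also have "\<dots> = (\<integral>\<^sup>+z. ennreal (min (F z) (X n z)) + ennreal (4 * B) * ennreal ((jump (\<lambda>x. f n x - u x) z)\<^sup>2) \<partial>pairs s)"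
        by (intro nn_integral_cong) (simp add: F0 X0 AB ennreal_mult[symmetric] ennreal_plus[symmetric] del: ennreal_plus)
      also have "\<dots> = (\<integral>\<^sup>+z. ennreal (min (F z) (X n z)) \<partial>pairs s) + ennreal (4 * B) * energy s (\<lambda>x. f n x - u x)"
        unfolding energy_def by (simp add: nn_integral_add nn_integral_cmult)
      finally show "energy s (\<lambda>x. w n x - v x) \<le> \<dots>" .
    qed
    have "(\<lambda>n. (\<integral>\<^sup>+z. ennreal (min (F z) (X n z)) \<partial>pairs s) + ennreal (4 * B) * energy s (\<lambda>x. f n x - u x))
        \<longlonglongrightarrow> (\<integral>\<^sup>+z. 0 \<partial>(pairs s :: ('a \<times> 'a) measure)) + ennreal (4 * B) * 0"
      by (intro tendsto_add min0 ennreal_tendsto_cmult lim) simp_all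
    then show "(\<lambda>n. (\<integral>\<^sup>+z. ennreal (min (F z) (X n z)) \<partial>pairs s) + ennreal (4 * B) * energy s (\<lambda>x. f n x - u x))
        \<longlonglongrightarrow> 0" by simp
  qed simp
  then have "v \<in> D_space s"
    using wc aew by (intro D_spaceI[OF s, of v w]) auto
  then show ?thesis by (simp add: v_def[abs_def] P_def soft_inverse_def divide_inverse)
qed

section \<open>Picone's inequality and weak solutions\<close>

text \<open>
  The difference of the two sides is a square divided by \<open>(e + t) (e + r)\<close>.
\<close>
lemma picone_inequality:
  fixes p q t r e :: real
  assumes "e > 0" "t \<ge> 0" "r \<ge> 0"
  shows "(t - r) * (p\<^sup>2 / (e + t) - q\<^sup>2 / (e + r)) \<le> (p - q)\<^sup>2"
proof -
  define T R where "T = e + t" and "R = e + r"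
  have pos: "T > 0" "R > 0" using assms by (auto simp: T_def R_def)
  have "(p - q)\<^sup>2 - (T - R) * (p\<^sup>2 / T - q\<^sup>2 / R) = (R * p - T * q)\<^sup>2 / (T * R)"
    using pos by (simp add: field_simps power2_eq_square)
  also have "\<dots> \<ge> 0" using pos by simp
  finally show ?thesis by (simp add: T_def R_def)
qed

text \<open>
  Where the solution vanishes at one of the two points, the gap in Picone's inequality is of order
  \<open>1 / e\<close>.
\<close>
lemma picone_gap_at_zero:
  fixes p q r e :: real
  assumes "e > 0" "r > 0"
  shows "r * p\<^sup>2 / e - q\<^sup>2 \<le> (p - q)\<^sup>2 - (0 - r) * (p\<^sup>2 / (e + 0) - q\<^sup>2 / (e + r))"
proof -
  have "r / (e + r) * q\<^sup>2 \<le> 1 * q\<^sup>2" using assms by (intro mult_right_mono) auto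
  then have "r * q\<^sup>2 / (e + r) \<le> q\<^sup>2" by simp
  moreover have "(p - q)\<^sup>2 - (0 - r) * (p\<^sup>2 / (e + 0) - q\<^sup>2 / (e + r))
      = (p - q)\<^sup>2 + r * p\<^sup>2 / e - r * q\<^sup>2 / (e + r)"
    by (simp add: algebra_simps)
  ultimately show ?thesis using zero_le_power2[of "p - q"] by linarith
qed

text \<open>
  The nonlinear term, tested with this nonnegative quotient, is nonnegative and can be dropped from the
  equation.
\<close>
lemma Q_form_quotient_nonneg:
  fixes u \<phi> :: "'a::euclidean_space \<Rightarrow> real"
  assumes s: "0 < s" "s < 1" and sol: "weak_solution s k lam a u" and \<phi>: "\<phi> \<in> Cc_infinity" and e: "e > 0"
  shows "(\<integral>x. H_pot s k lam a x * u x * ((\<phi> x)\<^sup>2 / (e + \<bar>u x\<bar>)) \<partial>lborel)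
    \<le> D_inner s u (\<lambda>x. (\<phi> x)\<^sup>2 / (e + \<bar>u x\<bar>))"
proof -
  let ?v = "\<lambda>x. (\<phi> x)\<^sup>2 / (e + \<bar>u x\<bar>)"
  have "u \<in> D_space s" using sol by (simp add: weak_solution_def)
  then have "?v \<in> D_space s" by (rule quotient_in_D_space[OF s _ \<phi> e])
  then have "Q_form s k lam a u ?v = (\<integral>x. u x powr (crit_exp DIM('a) s - 1) * ?v x \<partial>lborel)"
    using sol by (simp add: weak_solution_def)
  also have "\<dots> \<ge> 0" using e by (intro Bochner_Integration.integral_nonneg) auto
  finally show ?thesis by (simp add: Q_form_def)
qed

text \<open>
  A nontrivial solution forces the form to be nonnegative on test functions, by testing with
  \<open>\<phi>\<^sup>2 / (\<epsilon> + |u|)\<close> and letting \<open>\<epsilon>\<close> tend to \<open>0\<close>.  That the solution is nonzero almost everywhere on the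
  set where \<open>\<phi>\<close> is nonzero comes out of the same computation, from the uniform bound on the integrated gap \<open>R n\<close> in
  Picone's inequality.
\<close>
lemma weak_solution_Q_form_nonneg:
  fixes u \<phi> :: "'a::euclidean_space \<Rightarrow> real"
  assumes s: "0 < s" "s < 1" "2 * s < real DIM('a)"
    and sol: "weak_solution s k lam a u" and nontriv: "\<not> (AE x in lborel. u x = 0)"
    and \<phi>: "\<phi> \<in> Cc_infinity"
  shows "Q_form s k lam a \<phi> \<phi> \<ge> 0"
proof -
  let ?H = "H_pot s k lam a" and ?C = "C_const DIM('a) s"
  have C: "?C > 0" using C_const_pos[OF s(1,2)] .
  have u: "u \<in> D_space s" and upos: "AE x in lborel. u x \<ge> 0"
    using sol by (simp_all add: weak_solution_def)
  note [measurable] = D_space_measurable[OF u] Cc_infinity_measurable[OF \<phi>]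
  have [measurable]: "?H \<in> borel_measurable borel" unfolding H_pot_def by measurable
  define e where "e n = inverse (real (Suc n))" for n
  have e: "e n > 0" for n by (simp add: e_def)
  define v where "v n x = (\<phi> x)\<^sup>2 / (e n + \<bar>u x\<bar>)" for n x
  have v: "v n \<in> D_space s" for n
    unfolding v_def by (rule quotient_in_D_space[OF s(1,2) u \<phi> e])
  note [measurable] = D_space_measurable[OF v]
  have iuv: "integrable (pairs s) (\<lambda>z. jump u z * jump (v n) z)" for n
    by (intro integrable_jump_mult energy_D_space_finite s u v) auto
  have i\<phi>: "integrable (pairs s) (\<lambda>z. jump \<phi> z * jump \<phi> z)"
    by (intro integrable_jump_mult energy_Cc_infinity_finite s \<phi>) auto
  have iH: "integrable lborel (\<lambda>x. ?H x * \<phi> x * \<phi> x)"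
    by (rule H_pot_test[OF s(1,3) \<phi>])
  have uv: "\<bar>u x * v n x\<bar> \<le> \<bar>\<phi> x * \<phi> x\<bar>" for n x
  proof -
    have "\<bar>u x\<bar> / (e n + \<bar>u x\<bar>) \<le> 1" using e[of n] by (simp add: divide_le_eq_1 add_pos_nonneg)
    then have "(\<phi> x)\<^sup>2 * (\<bar>u x\<bar> / (e n + \<bar>u x\<bar>)) \<le> (\<phi> x)\<^sup>2 * 1" by (intro mult_left_mono) auto
    then show ?thesis
      using e[of n] by (simp add: v_def abs_mult power2_eq_square mult_ac)
  qed
  have dom: "norm (?H x * u x * v n x) \<le> \<bar>?H x * \<phi> x * \<phi> x\<bar>" for n x
    using mult_left_mono[OF uv[of x n], of "\<bar>?H x\<bar>"] by (simp add: abs_mult mult.assoc)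
  define R where "R n z = jump \<phi> z * jump \<phi> z - jump u z * jump (v n) z" for n z
  have [measurable]: "R n \<in> borel_measurable (pairs s)" for n unfolding R_def by measurable
  have Rnn: "AE z in pairs s. R n z \<ge> 0" for n
    using AE_pairs[OF upos]
  proof eventually_elim
    case (elim z)
    then show ?case
      using picone_inequality[OF e[of n], of "u (fst z)" "u (snd z)" "\<phi> (fst z)" "\<phi> (snd z)"]
      by (simp add: R_def jump_def v_def power2_eq_square)
  qed
  have Rint: "?C / 2 * (\<integral>z. R n z \<partial>pairs s) = D_inner s \<phi> \<phi> - D_inner s u (v n)" for n
    unfolding R_def by (simp add: D_inner_eq iuv i\<phi> right_diff_distrib)
  have test: "(\<integral>x. ?H x * u x * v n x \<partial>lborel) \<le> D_inner s u (v n)" for n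
    unfolding v_def by (rule Q_form_quotient_nonneg[OF s(1,2) sol \<phi> e])
  \<comment> \<open>a bound, independent of \<open>n\<close>, for the integrated gap; the factor inverts the \<open>C / 2\<close> in the scalar product\<close>
  define K where "K = 2 / ?C * (D_inner s \<phi> \<phi> + (\<integral>x. \<bar>?H x * \<phi> x * \<phi> x\<bar> \<partial>lborel))"
  have RK: "(\<integral>\<^sup>+z. ennreal (R n z) \<partial>pairs s) \<le> ennreal K" for n
  proof -
    have "integrable lborel (\<lambda>x. ?H x * u x * v n x)"
      by (rule Bochner_Integration.integrable_bound[OF integrable_abs[OF iH]]) (use dom in auto)
    then have "(\<integral>x. - (?H x * u x * v n x) \<partial>lborel) \<le> (\<integral>x. \<bar>?H x * \<phi> x * \<phi> x\<bar> \<partial>lborel)"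
      using dom[of x n for x] by (intro integral_mono integrable_abs[OF iH]) (auto simp: abs_le_iff)
    then have "- (\<integral>x. ?H x * u x * v n x \<partial>lborel) \<le> (\<integral>x. \<bar>?H x * \<phi> x * \<phi> x\<bar> \<partial>lborel)"
      by simp
    moreover have "?C / 2 * K = D_inner s \<phi> \<phi> + (\<integral>x. \<bar>?H x * \<phi> x * \<phi> x\<bar> \<partial>lborel)"
      using C by (simp add: K_def)
    ultimately have "?C / 2 * (\<integral>z. R n z \<partial>pairs s) \<le> ?C / 2 * K"
      using Rint[of n] test[of n] by linarith
    then have "(\<integral>z. R n z \<partial>pairs s) \<le> K" using C by (subst (asm) mult_le_cancel_left_pos) simp_all
    moreover have "(\<integral>\<^sup>+z. ennreal (R n z) \<partial>pairs s) = ennreal (\<integral>z. R n z \<partial>pairs s)"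
      using Rnn iuv i\<phi> by (intro nn_integral_eq_integral) (auto simp: R_def)
    ultimately show ?thesis by (simp add: ennreal_leI)
  qed
  \<comment> \<open>by Fatou the gap cannot tend to infinity on a set of positive measure\<close>
  have "(\<integral>\<^sup>+z. liminf (\<lambda>n. ennreal (R n z)) \<partial>pairs s) \<le> liminf (\<lambda>n. \<integral>\<^sup>+z. ennreal (R n z) \<partial>pairs s)"
    by (intro nn_integral_liminf) measurable
  also have "\<dots> \<le> liminf (\<lambda>n. ennreal K)" by (intro Liminf_mono always_eventually allI RK)
  also have "\<dots> = ennreal K" by (simp add: Liminf_const)
  finally have "(\<integral>\<^sup>+z. liminf (\<lambda>n. ennreal (R n z)) \<partial>pairs s) \<noteq> \<infinity>"
    by (auto simp: top_unique)
  then have "AE z in pairs s. liminf (\<lambda>n. ennreal (R n z)) \<noteq> \<infinity>"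
    by (intro nn_integral_PInf_AE) auto
  then have "AE z in pairs s. \<not> (u (fst z) = 0 \<and> \<phi> (fst z) \<noteq> 0 \<and> u (snd z) > 0)"
  proof eventually_elim
    case (elim z)
    show ?case
    proof
      assume z: "u (fst z) = 0 \<and> \<phi> (fst z) \<noteq> 0 \<and> u (snd z) > 0"
      let ?p = "\<phi> (fst z)" and ?q = "\<phi> (snd z)" and ?r = "u (snd z)"
      have "filterlim (\<lambda>n. ?r * ?p\<^sup>2 * real (Suc n)) at_top sequentially"
        using z by (intro filterlim_tendsto_pos_mult_at_top[OF tendsto_const]
            filterlim_compose[OF filterlim_real_sequentially filterlim_Suc]) auto
      from filterlim_tendsto_add_at_top[OF tendsto_const[of "- (?q\<^sup>2)"] this]
      have "filterlim (\<lambda>n. R n z) at_top sequentially"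
      proof (rule filterlim_at_top_mono, intro always_eventually allI)
        fix n
        show "- (?q\<^sup>2) + ?r * ?p\<^sup>2 * real (Suc n) \<le> R n z"
          using picone_gap_at_zero[OF e[of n], of ?r ?p ?q] z
          by (simp add: R_def jump_def v_def e_def divide_inverse power2_eq_square)
      qed
      then have "(\<lambda>n. ennreal (R n z)) \<longlonglongrightarrow> \<infinity>"
        by (simp add: ennreal_tendsto_top_eq_at_top)
      then have "liminf (\<lambda>n. ennreal (R n z)) = \<infinity>" by (intro lim_imp_Liminf) auto
      with elim show False by simp
    qed
  qed
  \<comment> \<open>the kernel vanishes on the diagonal, where the condition is void: \<open>u(x) = 0\<close> excludes \<open>u(x) > 0\<close>\<close>
  then have "AE z in lborel \<Otimes>\<^sub>M lborel. fst z \<noteq> snd z \<longrightarrow>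
      \<not> (u (fst z) = 0 \<and> \<phi> (fst z) \<noteq> 0 \<and> u (snd z) > 0)"
    unfolding pairs_def by (subst (asm) AE_density) (auto elim!: eventually_mono)
  then have "AE z in lborel \<Otimes>\<^sub>M lborel. \<not> (u (fst z) = 0 \<and> \<phi> (fst z) \<noteq> 0 \<and> u (snd z) > 0)"
    by eventually_elim auto
  from lborel_pair.AE_pair[OF this]
  have "AE x in lborel. AE y in lborel. \<not> (u x = 0 \<and> \<phi> x \<noteq> 0 \<and> u y > 0)" by simp
  then have unz: "AE x in lborel. \<phi> x \<noteq> 0 \<longrightarrow> u x \<noteq> 0"
  proof eventually_elim
    case (elim x)
    show ?case
    proof (intro impI notI)
      assume x: "\<phi> x \<noteq> 0" "u x = 0"
      have "AE y in lborel. u y = 0"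
        using elim upos by eventually_elim (use x in auto)
      with nontriv show False by simp
    qed
  qed
  have "(\<lambda>n. \<integral>x. ?H x * u x * v n x \<partial>lborel) \<longlonglongrightarrow> (\<integral>x. ?H x * \<phi> x * \<phi> x \<partial>lborel)"
  proof (rule integral_dominated_convergence[where w = "\<lambda>x. \<bar>?H x * \<phi> x * \<phi> x\<bar>"])
    show "AE x in lborel. (\<lambda>n. ?H x * u x * v n x) \<longlonglongrightarrow> ?H x * \<phi> x * \<phi> x"
      using unz upos
    proof eventually_elim
      case (elim x)
      show ?case
      proof (cases "\<phi> x = 0")
        case False
        with elim have ux: "u x > 0" by auto
        have "e \<longlonglongrightarrow> 0" unfolding e_def by (rule LIMSEQ_inverse_real_of_nat)
        then have "(\<lambda>n. ?H x * u x * v n x) \<longlonglongrightarrow> ?H x * u x * ((\<phi> x)\<^sup>2 / (0 + \<bar>u x\<bar>))"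
          unfolding v_def using ux by (intro tendsto_intros) auto
        also have "?H x * u x * ((\<phi> x)\<^sup>2 / (0 + \<bar>u x\<bar>)) = ?H x * \<phi> x * \<phi> x"
          using ux by (simp add: power2_eq_square)
        finally show ?thesis .
      qed (simp add: v_def)
    qed
    show "integrable lborel (\<lambda>x. \<bar>?H x * \<phi> x * \<phi> x\<bar>)" by (rule integrable_abs[OF iH])
    show "AE x in lborel. norm (?H x * u x * v n x) \<le> \<bar>?H x * \<phi> x * \<phi> x\<bar>" for n
      using dom by simp
  qed measurable
  moreover have "(\<integral>x. ?H x * u x * v n x \<partial>lborel) \<le> D_inner s \<phi> \<phi>" for n
  proof -
    have "0 \<le> ?C / 2 * (\<integral>z. R n z \<partial>pairs s)"
      using C Rnn[of n] by (intro mult_nonneg_nonneg integral_nonneg_AE) auto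
    with Rint[of n] test[of n] show ?thesis by linarith
  qed
  ultimately have "(\<integral>x. ?H x * \<phi> x * \<phi> x \<partial>lborel) \<le> D_inner s \<phi> \<phi>"
    by (intro LIMSEQ_le_const2) auto
  then show ?thesis by (simp add: Q_form_def)
qed

theorem theorem1p5:
  fixes s :: real and k :: nat
    and lam :: "nat \<Rightarrow> real"
    and a :: "nat \<Rightarrow> 'a::euclidean_space"
  assumes "0 < s" and "s < 1"
    and "real DIM('a) > 2 * s"
    and "k \<ge> 2"
    and "mono_on {1..k} lam"
    and "(\<exists>i\<in>{1..k}. lam i > hardy_const TYPE('a) s)
         \<or> (\<Sum>i=1..k. lam i) > hardy_const TYPE('a) s"
    and "inj_on a {1..k}"
  shows "(\<exists>u \<in> D_space s. Q_form s k lam a u u < 0)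
    \<and> mu_inf s k lam a < 0
    \<and> \<not> (\<exists>u. weak_solution s k lam a u \<and> \<not> (AE x in lborel. u x = 0))"
proof -
  note s = assms(1-3)
  obtain \<phi> where \<phi>: "\<phi> \<in> Cc_infinity" and neg: "Q_form s k lam a \<phi> \<phi> < 0"
    using assms(6) Q_form_negative_pole[OF s assms(7)] Q_form_negative_sum[OF s] by blast
  have D: "\<phi> \<in> D_space s" by (rule Cc_infinity_subset_D_space[OF s(1,2) \<phi>])
  note pos = D_norm_pos_of_Q_form_negative[OF s(1,2) \<phi> neg]
  have "mu_inf s k lam a \<le> ereal (Q_form s k lam a \<phi> \<phi> / (D_norm s \<phi>)\<^sup>2)"
    unfolding mu_inf_def using D pos(2) by (intro INF_lower) auto
  also have "\<dots> < 0" using neg pos(1) by (simp add: divide_neg_pos)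
  finally show ?thesis
    using D neg weak_solution_Q_form_nonneg[OF s _ _ \<phi>] by (auto simp: not_le[symmetric])
qed

end
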